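(* Let $A=I-N\in\mathbb R^{n\times n}$, where $N\ge 0$, $\mathrm{diag}(N)>0$ (i.e., all diagonal entries of $N$ are positive) and $\rho(N)\le 1$, be an M-matrix with property C. Then the principal square root $A^{1/2}$ is an M-matrix of the form $A^{1/2}=I-G$ with $G\ge 0$, $\rho(G)\le 1$, where $G=\lim_{k\to\infty}G_k$ and the sequence $\{G_k\}_k$ is defined by $$G_{k+1}=\tfrac12\,(G_k^2+N),\quad k=0,1,2,\ldots,\qquad G_0=0.$$ Moreover, $G$ is the minimal nonnegative solution of the matrix equation $X^2-2X+N=0$. Finally, if $A$ is singular, then $\rho(G)=1$, and if $\boldsymbol u>0$ is a vector such that $(I-N)\boldsymbol u=0$, then $G\boldsymbol u=\boldsymbol u$. If $A$ is singular and, in addition, $1$ is a simple eigenvalue of $N$, then $1$ is the only eigenvalue of $G$ of modulus $1$.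
   Context: All inequalities between real matrices or vectors are entry-wise; $\rho(\cdot)$ denotes the spectral radius. An M-matrix is a real square matrix of the form $A=\alpha I-B$ with $B\ge 0$, $\alpha>0$ and $\rho(B)\le\alpha$. An M-matrix $A$ satisfies property C if either $\det A\ne 0$ or $0$ is a semisimple eigenvalue of $A$. For an M-matrix $A$ with property C, $A^{1/2}$ denotes its principal square root, namely the unique matrix $Y$ with $Y^2=A$ whose eigenvalues all have nonnegative real part and which is primary, i.e., a polynomial in $A$. A minimal nonnegative solution of a matrix equation is a solution $G\ge 0$ such that $G\le Y$ for every solution $Y\ge 0$ of the same equation. An eigenvalue is simple if it has algebraic multiplicity $1$. *)

theory Defs
  imports "Jordan_Normal_Form.Spectral_Radius"
    "Jordan_Normal_Form.Jordan_Normal_Form_Uniqueness"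
begin

text \<open>The order on real matrices from \<^theory>\<open>Jordan_Normal_Form.Matrix\<close> is the entry-wise one.
  Eigenvalues of a real matrix are the complex eigenvalues of its complexification.\<close>

abbreviation cmat :: "real mat \<Rightarrow> complex mat" where
  "cmat \<equiv> map_mat complex_of_real"

abbreviation rho :: "real mat \<Rightarrow> real" where
  "rho A \<equiv> spectral_radius (cmat A)"

abbreviation algebraic_mult :: "'a::field mat \<Rightarrow> 'a \<Rightarrow> nat" where
  "algebraic_mult A x \<equiv> Polynomial.order x (char_poly A)"

definition simple_eigenvalue :: "'a::field mat \<Rightarrow> 'a \<Rightarrow> bool" where
  "simple_eigenvalue A x \<longleftrightarrow> eigenvalue A x \<and> algebraic_mult A x = 1"

text \<open>The geometric multiplicity of an eigenvalue is the dimension of the kernel of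
  \<^term>\<open>char_matrix A x\<close>, which is \<open>A - x I\<close>.\<close>

definition semisimple_eigenvalue :: "'a::field mat \<Rightarrow> 'a \<Rightarrow> bool" where
  "semisimple_eigenvalue A x \<longleftrightarrow>
     eigenvalue A x \<and> algebraic_mult A x = kernel_dim (char_matrix A x)"

definition M_matrix :: "nat \<Rightarrow> real mat \<Rightarrow> bool" where
  "M_matrix n A \<longleftrightarrow>
     (\<exists>\<alpha> B. B \<in> carrier_mat n n \<and> 0\<^sub>m n n \<le> B \<and> \<alpha> > 0 \<and> rho B \<le> \<alpha> \<and>
        A = \<alpha> \<cdot>\<^sub>m 1\<^sub>m n - B)"

definition property_C :: "real mat \<Rightarrow> bool" where
  "property_C A \<longleftrightarrow> det A \<noteq> 0 \<or> semisimple_eigenvalue A 0"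

definition poly_mat :: "complex poly \<Rightarrow> complex mat \<Rightarrow> complex mat" where
  "poly_mat p A = mat (dim_row A) (dim_row A)
     (\<lambda>(i, j). \<Sum>k\<le>degree p. coeff p k * (A ^\<^sub>m k) $$ (i, j))"

definition is_principal_sqrt :: "complex mat \<Rightarrow> complex mat \<Rightarrow> bool" where
  "is_principal_sqrt A Y \<longleftrightarrow>
     Y \<in> carrier_mat (dim_row A) (dim_row A) \<and> Y * Y = A \<and>
     (\<forall>z. eigenvalue Y z \<longrightarrow> Re z \<ge> 0) \<and> (\<exists>p. Y = poly_mat p A)"

text \<open>This is only meaningful for matrices that have exactly one principal square root.\<close>

definition principal_sqrt :: "complex mat \<Rightarrow> complex mat" where
  "principal_sqrt A = (THE Y. is_principal_sqrt A Y)"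

definition mat_tendsto :: "nat \<Rightarrow> (nat \<Rightarrow> real mat) \<Rightarrow> real mat \<Rightarrow> bool" where
  "mat_tendsto n X L \<longleftrightarrow> (\<forall>k. X k \<in> carrier_mat n n) \<and> L \<in> carrier_mat n n \<and>
     (\<forall>i<n. \<forall>j<n. (\<lambda>k. X k $$ (i, j)) \<longlonglongrightarrow> L $$ (i, j))"

primrec sqrt_iter :: "real mat \<Rightarrow> nat \<Rightarrow> real mat" where
  "sqrt_iter N 0 = 0\<^sub>m (dim_row N) (dim_row N)"
| "sqrt_iter N (Suc k) = (1/2) \<cdot>\<^sub>m (sqrt_iter N k * sqrt_iter N k + N)"

definition minimal_nonneg_solution :: "nat \<Rightarrow> (real mat \<Rightarrow> bool) \<Rightarrow> real mat \<Rightarrow> bool" where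
  "minimal_nonneg_solution n eqn X \<longleftrightarrow>
     X \<in> carrier_mat n n \<and> 0\<^sub>m n n \<le> X \<and> eqn X \<and>
     (\<forall>Y \<in> carrier_mat n n. 0\<^sub>m n n \<le> Y \<and> eqn Y \<longrightarrow> X \<le> Y)"

end

theory Submission
  imports Defs
begin

text \<open>Since \<open>N\<close> has a positive diagonal, \<open>1\<close> is its only possible eigenvalue of modulus \<open>1\<close>, and
  property C makes this eigenvalue semisimple if it occurs; hence the powers of \<open>N\<close> are bounded. The
  size \<open>sup\<^sub>k \<parallel>N\<^sup>k y\<parallel>\<^sub>\<infinity>\<close> on nonnegative vectors is then finite and is not increased by \<open>N\<close>,
  hence not by the iterates and their powers either, which bounds all of these. The increasing sequence
  therefore converges to some \<open>G\<close> with bounded powers, so \<open>rho G \<le> 1\<close>, and passing to the limit gives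
  \<open>(I - G)\<^sup>2 = I - N\<close>. The polynomials in \<open>A\<close> form a closed subspace, so \<open>I - G\<close> is a primary
  square root. As \<open>2 G \<ge> N\<close>, the matrix \<open>G\<close> has a positive diagonal too, and the diagonal argument
  applied to \<open>G\<close> itself leaves \<open>1\<close> as the only possible eigenvalue of modulus \<open>1\<close>.\<close>

subsection \<open>Growth of nonnegative matrices\<close>

text \<open>A positive vector u with N u \<le> u would bound the iterates at once, but for reducible
  N it need not exist: the matrix with rows (1, 1) and (0, 1/2) has a positive diagonal and bounded
  powers, yet N u \<le> u forces u_2 \<le> 0. This is why size is measured along the whole orbit N^k
  y. There N only shifts the orbit, and not increasing the size is a property stable under products,
  averages and limits, the operations from which \<open>G\<close> is built. Some condition at the
  eigenvalue 1 is unavoidable: for N with rows (1, 1) and (0, 1), the matrix I - N is nilpotent and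
  has no square root, so the monotone iterates cannot stay bounded. Since
  \<open>principal_sqrt\<close> is a definite description, uniqueness of the root is part of the
  claim. The delicate case is a singular \<open>A\<close>. Bounded powers of \<open>N\<close> help a
  second time there: they make the kernels of \<open>A\<close> and of its square coincide.\<close>

lemma mult_mat_vec_index:
  assumes "M \<in> carrier_mat n m" "v \<in> carrier_vec m" "i < n"
  shows "(M *\<^sub>v v) $ i = (\<Sum>j<m. M $$ (i, j) * v $ j)"
  using assms by (auto simp: scalar_prod_def atLeast0LessThan)

lemma mult_mat_index:
  assumes "A \<in> carrier_mat n m" "B \<in> carrier_mat m l" "i < n" "j < l"
  shows "(A * B) $$ (i, j) = (\<Sum>k<m. A $$ (i, k) * B $$ (k, j))"
  using assms by (auto simp: scalar_prod_def atLeast0LessThan)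

lemma nonneg_mat_mult:
  fixes A B :: "real mat"
  assumes A: "A \<in> carrier_mat n n" "0\<^sub>m n n \<le> A" and B: "B \<in> carrier_mat n n" "0\<^sub>m n n \<le> B"
  shows "0\<^sub>m n n \<le> A * B"
  unfolding less_eq_mat_def
proof (intro conjI allI impI)
  fix i j assume "i < dim_row (A * B)" "j < dim_col (A * B)"
  then have ij: "i < n" "j < n" using A B by auto
  have "0 \<le> (\<Sum>k<n. A $$ (i, k) * B $$ (k, j))"
    using A B ij by (intro sum_nonneg mult_nonneg_nonneg) (auto simp: less_eq_mat_def)
  then show "0\<^sub>m n n $$ (i, j) \<le> (A * B) $$ (i, j)"
    using ij by (simp add: mult_mat_index[OF A(1) B(1) ij] del: index_mult_mat)
qed (use A B in auto)

lemma nonneg_mat_pow: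
  fixes M :: "real mat"
  assumes M: "M \<in> carrier_mat n n" and nn: "0\<^sub>m n n \<le> M"
  shows "0\<^sub>m n n \<le> M ^\<^sub>m k"
proof (induction k)
  case 0
  show ?case using M by (auto simp: less_eq_mat_def)
next
  case (Suc k)
  show ?case unfolding pow_mat.simps
    by (rule nonneg_mat_mult[OF _ Suc M nn]) (use M in simp)
qed

lemma supereigenvector_pow:
  fixes M :: "real mat"
  assumes M: "M \<in> carrier_mat n n" and nn: "0\<^sub>m n n \<le> M"
    and w: "w \<in> carrier_vec n" and t: "t \<ge> 0"
    and le: "\<And>i. i < n \<Longrightarrow> t * w $ i \<le> (M *\<^sub>v w) $ i"
    and i: "i < n"
  shows "t ^ k * w $ i \<le> (M ^\<^sub>m k *\<^sub>v w) $ i"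
  using i
proof (induction k arbitrary: i)
  case 0
  then show ?case using M w by simp
next
  case (Suc k)
  have Mk: "M ^\<^sub>m k \<in> carrier_mat n n" using M by simp
  have nnk: "0 \<le> (M ^\<^sub>m k) $$ (i, j)" if "j < n" for j
    using nonneg_mat_pow[OF M nn, of k] Mk Suc.prems that by (auto simp: less_eq_mat_def)
  have "t ^ Suc k * w $ i \<le> t * (M ^\<^sub>m k *\<^sub>v w) $ i"
    using mult_left_mono[OF Suc.IH[OF Suc.prems] t] by (simp add: mult.assoc)
  also have "\<dots> = (\<Sum>j<n. (M ^\<^sub>m k) $$ (i, j) * (t * w $ j))"
    unfolding mult_mat_vec_index[OF Mk w Suc.prems] by (simp add: sum_distrib_left mult_ac)
  also have "\<dots> \<le> (\<Sum>j<n. (M ^\<^sub>m k) $$ (i, j) * (M *\<^sub>v w) $ j)"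
    by (intro sum_mono mult_left_mono le nnk) auto
  also have "\<dots> = (M ^\<^sub>m k *\<^sub>v (M *\<^sub>v w)) $ i"
    using M w by (subst mult_mat_vec_index[OF Mk _ Suc.prems]) auto
  also have "M ^\<^sub>m k *\<^sub>v (M *\<^sub>v w) = M ^\<^sub>m Suc k *\<^sub>v w"
    using assoc_mult_mat_vec[OF Mk M w] by simp
  finally show ?case .
qed

lemma exp_not_le_poly:
  fixes t a c1 c2 :: real
  assumes "a > 0" and le: "\<And>k. t ^ k * a \<le> c1 + c2 * real k ^ d"
  shows "t \<le> 1"
proof (rule ccontr)
  assume "\<not> t \<le> 1"
  \<comment> \<open>The power of t is split into two copies of s^k: one outgrows the polynomial, and
    the other is left over to diverge.\<close>
  define s where "s = sqrt t"
  have s: "s > 1" and st: "t = s * s" using \<open>\<not> t \<le> 1\<close> by (auto simp: s_def)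
  obtain p where p: "\<And>k. (\<bar>c1\<bar> + \<bar>c2\<bar>) * (1/s) ^ k * max 1 (real k ^ d) \<le> p"
    using poly_exp_max_constant_bound[of "1/s" "\<bar>c1\<bar> + \<bar>c2\<bar>" d] s by auto
  have "s ^ k * a \<le> p" for k
  proof -
    have "c1 \<le> \<bar>c1\<bar> * max 1 (real k ^ d)"
      by (rule order_trans[OF abs_ge_self]) (simp add: mult_le_cancel_left1)
    moreover have "c2 * real k ^ d \<le> \<bar>c2\<bar> * max 1 (real k ^ d)"
      by (intro mult_mono) auto
    ultimately have "t ^ k * a \<le> (\<bar>c1\<bar> + \<bar>c2\<bar>) * max 1 (real k ^ d)"
      using le[of k] by (simp add: distrib_right)
    then have "t ^ k * a * (1/s) ^ k \<le> (\<bar>c1\<bar> + \<bar>c2\<bar>) * max 1 (real k ^ d) * (1/s) ^ k"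
      using s by (intro mult_right_mono) auto
    also have "\<dots> \<le> p" using p[of k] by (simp add: mult_ac)
    finally show ?thesis using s by (simp add: st power_mult_distrib power_divide)
  qed
  moreover obtain k where "p / a < s ^ k" using real_arch_pow[OF s] by blast
  then have "p < s ^ k * a" using \<open>a > 0\<close> by (simp only: pos_divide_less_eq)
  ultimately show False by (meson not_le)
qed

lemma cmat_pow:
  assumes "M \<in> carrier_mat n n"
  shows "cmat M ^\<^sub>m k = cmat (M ^\<^sub>m k)"
  by (rule of_real_hom.mat_hom_pow[OF assms, symmetric])

text \<open>This is the lower Collatz-Wielandt bound. Iterating the inequality makes a positive
  coordinate of \<open>w\<close> grow like t^k, while the Jordan form allows only polynomial growth
  when \<open>rho M \<le> 1\<close>. The powers of \<open>M\<close> may really be unbounded here, so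
  the comparison is with a polynomial rather than a constant.\<close>

lemma supereigenvector_le_1:
  fixes M :: "real mat"
  assumes M: "M \<in> carrier_mat n n" and nn: "0\<^sub>m n n \<le> M" and rho: "rho M \<le> 1"
    and w: "w \<in> carrier_vec n" and w0: "\<And>i. i < n \<Longrightarrow> 0 \<le> w $ i" and wn0: "w \<noteq> 0\<^sub>v n"
    and t: "t \<ge> 0" and le: "\<And>i. i < n \<Longrightarrow> t * w $ i \<le> (M *\<^sub>v w) $ i"
  shows "t \<le> 1"
proof -
  have cM: "cmat M \<in> carrier_mat n n" using M by simp
  obtain c1 c2 where b: "\<And>k. norm_bound (cmat M ^\<^sub>m k) (c1 + c2 * real k ^ (n - 1))"
    using spectral_radius_jnf_norm_bound_le_1_upper_triangular[OF cM rho] by auto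
  have bd: "(M ^\<^sub>m k) $$ (i, j) \<le> c1 + c2 * real k ^ (n - 1)" if "i < n" "j < n" for k i j
  proof -
    have "cmod (cmat (M ^\<^sub>m k) $$ (i, j)) \<le> c1 + c2 * real k ^ (n - 1)"
      using b[of k] that M unfolding norm_bound_def cmat_pow[OF M] by simp
    then show ?thesis using that M by simp
  qed
  obtain i where i: "i < n" "w $ i > 0"
  proof -
    have "\<exists>i<n. w $ i \<noteq> 0"
      using wn0 w by (auto intro!: eq_vecI)
    with w0 that show thesis by (force simp: less_le)
  qed
  define W where "W = (\<Sum>j<n. w $ j)"
  have "t ^ k * w $ i \<le> c1 * W + c2 * W * real k ^ (n - 1)" for k
  proof -
    have "t ^ k * w $ i \<le> (M ^\<^sub>m k *\<^sub>v w) $ i"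
      by (rule supereigenvector_pow[OF M nn w t le i(1)])
    also have "\<dots> = (\<Sum>j<n. (M ^\<^sub>m k) $$ (i, j) * w $ j)"
      using M by (intro mult_mat_vec_index[OF _ w i(1)]) simp
    also have "\<dots> \<le> (\<Sum>j<n. (c1 + c2 * real k ^ (n - 1)) * w $ j)"
      by (intro sum_mono mult_right_mono bd i w0) auto
    also have "\<dots> = c1 * W + c2 * W * real k ^ (n - 1)"
      unfolding W_def sum_distrib_left[symmetric] by (simp only: algebra_simps)
    finally show ?thesis .
  qed
  from exp_not_le_poly[OF i(2) this] show ?thesis .
qed

lemma cmat_eigenvector_index:
  assumes M: "M \<in> carrier_mat n n" and ev: "eigenvector (cmat M) v z"
  shows "v \<in> carrier_vec n" "v \<noteq> 0\<^sub>v n"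
    and "\<And>i. i < n \<Longrightarrow> z * v $ i = (\<Sum>j<n. of_real (M $$ (i, j)) * v $ j)"
proof -
  show v: "v \<in> carrier_vec n" and "v \<noteq> 0\<^sub>v n" using ev M unfolding eigenvector_def by auto
  fix i assume i: "i < n"
  have "z * v $ i = (cmat M *\<^sub>v v) $ i" using ev v i unfolding eigenvector_def by simp
  also have "\<dots> = (\<Sum>j<n. cmat M $$ (i, j) * v $ j)"
    using M by (intro mult_mat_vec_index[OF _ v i]) simp
  finally show "z * v $ i = (\<Sum>j<n. of_real (M $$ (i, j)) * v $ j)" using M i by simp
qed

text \<open>With \<open>\<delta>\<close> the least diagonal entry, \<open>M - \<delta> I\<close> is still nonnegative, so the
  absolute values of an eigenvector for \<open>z\<close> show that \<open>M\<close> grows at least like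
  \<open>\<delta> + \<bar>z - \<delta>\<bar>\<close>; this exceeds \<open>1\<close> unless \<open>z = 1\<close>.\<close>

lemma peripheral_eigenvalue_pos_diag:
  fixes M :: "real mat"
  assumes M: "M \<in> carrier_mat n n" and nn: "0\<^sub>m n n \<le> M" and rho: "rho M \<le> 1"
    and diag: "\<And>i. i < n \<Longrightarrow> M $$ (i, i) > 0"
    and ev: "eigenvalue (cmat M) z" and z: "cmod z = 1"
  shows "z = 1"
proof -
  from ev obtain v where v: "eigenvector (cmat M) v z" unfolding eigenvalue_def by auto
  note V = cmat_eigenvector_index[OF M v]
  have n: "n > 0" using V by (cases n) auto
  define \<delta> where "\<delta> = Min ((\<lambda>i. M $$ (i, i)) ` {..<n})"
  have \<delta>: "\<delta> > 0" using n diag unfolding \<delta>_def by (subst Min_gr_iff) auto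
  have \<delta>_le: "\<delta> \<le> M $$ (i, i)" if "i < n" for i
    using that unfolding \<delta>_def by (intro Min_le) auto
  define w where "w = vec n (\<lambda>i. cmod (v $ i))"
  define D where "D = (\<lambda>i j. M $$ (i, j) - (if i = j then \<delta> else 0))"
  have D: "D i j \<ge> 0" if "i < n" "j < n" for i j
    using that nn M \<delta>_le by (auto simp: D_def less_eq_mat_def)
  have w: "w \<in> carrier_vec n" by (simp add: w_def)
  have le: "(\<delta> + cmod (z - \<delta>)) * w $ i \<le> (M *\<^sub>v w) $ i" if i: "i < n" for i
  proof -
    have "(z - \<delta>) * v $ i = (\<Sum>j<n. of_real (M $$ (i, j)) * v $ j) - (\<Sum>j<n. if i = j then \<delta> * v $ j else 0)"
      using i V(3)[OF i] by (simp add: algebra_simps sum.delta)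
    also have "\<dots> = (\<Sum>j<n. of_real (D i j) * v $ j)"
      unfolding sum_subtractf[symmetric] by (intro sum.cong) (auto simp: D_def algebra_simps)
    finally have "cmod (z - \<delta>) * w $ i = cmod (\<Sum>j<n. of_real (D i j) * v $ j)"
      using i by (simp add: w_def norm_mult[symmetric])
    also have "\<dots> \<le> (\<Sum>j<n. D i j * w $ j)"
      by (rule order_trans[OF norm_sum], rule sum_mono) (use D i in \<open>auto simp: w_def norm_mult\<close>)
    also have "\<dots> = (\<Sum>j<n. M $$ (i, j) * w $ j) - (\<Sum>j<n. if i = j then \<delta> * w $ j else 0)"
      unfolding sum_subtractf[symmetric] by (intro sum.cong) (auto simp: D_def algebra_simps)
    also have "\<dots> = (M *\<^sub>v w) $ i - \<delta> * w $ i"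
      using i by (simp add: mult_mat_vec_index[OF M w i] sum.delta)
    finally show ?thesis by (simp add: algebra_simps)
  qed
  have "w \<noteq> 0\<^sub>v n"
  proof
    assume "w = 0\<^sub>v n"
    then have "w $ i = 0" if "i < n" for i using that by simp
    then have "v $ i = 0" if "i < n" for i using that by (simp add: w_def)
    with V show False by auto
  qed
  then have "\<delta> + cmod (z - \<delta>) \<le> 1"
    using \<delta> by (intro supereigenvector_le_1[OF M nn rho w _ _ _ le]) (auto simp: w_def)
  \<comment> \<open>Geometrically, the disc of radius 1 - \<delta> about \<delta> touches the unit
    circle only at 1.\<close>
  then have "(cmod (z - \<delta>))\<^sup>2 \<le> (1 - \<delta>)\<^sup>2" by (intro power_mono) auto
  moreover have zz: "(Re z)\<^sup>2 + (Im z)\<^sup>2 = 1" using z by (simp add: cmod_power2[symmetric])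
  ultimately have "2 * \<delta> \<le> 2 * \<delta> * Re z"
    by (simp add: cmod_power2 power2_diff algebra_simps)
  then have "1 \<le> Re z" using \<delta> by simp
  moreover have "Re z \<le> 1" using complex_Re_le_cmod[of z] z by simp
  ultimately have "Re z = 1" by simp
  with zz show "z = 1" by (simp add: complex_eq_iff)
qed

text \<open>Along an eigenvector of maximal modulus the powers act as z^k, so a bounded family
  excludes modulus above 1. The summand \<open>0 * real k ^ 0\<close> only gives the bound the shape
  of \<open>exp_not_le_poly\<close>.\<close>

lemma power_bounded_imp_spectral_radius_le_1:
  assumes A: "A \<in> carrier_mat n n" and n: "n > 0" and b: "\<And>k. norm_bound (A ^\<^sub>m k) c"
  shows "spectral_radius A \<le> 1"
proof -
  obtain z where z: "eigenvalue A z" and sr: "spectral_radius A = cmod z"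
    using spectral_radius_mem_max(1)[OF A n] unfolding spectrum_def by auto
  from z obtain v where v: "eigenvector A v z" unfolding eigenvalue_def by auto
  then have vc: "v \<in> carrier_vec n" and v0: "v \<noteq> 0\<^sub>v n" using A unfolding eigenvector_def by auto
  then obtain i where i: "i < n" "v $ i \<noteq> 0"
    using eq_vecI[of v "0\<^sub>v n"] by auto
  have "cmod z ^ k * cmod (v $ i) \<le> c * (\<Sum>j<n. cmod (v $ j)) + 0 * real k ^ 0" for k
  proof -
    have Ak: "A ^\<^sub>m k \<in> carrier_mat n n" using A by simp
    have "cmod z ^ k * cmod (v $ i) = cmod ((A ^\<^sub>m k *\<^sub>v v) $ i)"
      using eigenvector_pow[OF A v] vc i by (simp add: norm_mult norm_power)
    also have "\<dots> = cmod (\<Sum>j<n. (A ^\<^sub>m k) $$ (i, j) * v $ j)"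
      by (simp add: mult_mat_vec_index[OF Ak vc i(1)])
    also have "\<dots> \<le> (\<Sum>j<n. c * cmod (v $ j))"
      by (rule order_trans[OF norm_sum], rule sum_mono)
        (use b[of k] i carrier_matD[OF Ak] in \<open>auto simp: norm_mult norm_bound_def
          simp del: pow_mat_dim intro!: mult_right_mono\<close>)
    also have "\<dots> = c * (\<Sum>j<n. cmod (v $ j)) + 0 * real k ^ 0"
      by (simp only: sum_distrib_left mult_zero_left add_0_right)
    finally show ?thesis .
  qed
  from exp_not_le_poly[OF _ this] i(2) show ?thesis by (simp add: sr)
qed

lemma eigenvalue_cmat_norm_le_1:
  assumes X: "X \<in> carrier_mat n n" "rho X \<le> 1" and ev: "eigenvalue (cmat X) z"
  shows "cmod z \<le> 1"
proof -
  have cX: "cmat X \<in> carrier_mat n n" using X by simp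
  have "cmod z \<in> norm ` spectrum (cmat X)" using ev by (auto simp: spectrum_def)
  from spectral_radius_mem_max(2)[OF cX eigenvalue_imp_nonzero_dim[OF cX ev] this] X(2)
  show ?thesis by simp
qed

lemma eigenvalue_one_minus:
  assumes X: "X \<in> carrier_mat n n" and ev: "eigenvalue (cmat (1\<^sub>m n - X)) z"
  shows "eigenvalue (cmat X) (1 - z)"
proof -
  have cX: "cmat X \<in> carrier_mat n n" using X by simp
  obtain v where v: "v \<in> carrier_vec n" "v \<noteq> 0\<^sub>v n" "cmat (1\<^sub>m n - X) *\<^sub>v v = z \<cdot>\<^sub>v v"
    using ev X unfolding eigenvalue_def eigenvector_def by auto
  have "cmat (1\<^sub>m n - X) = 1\<^sub>m n - cmat X" using X by (intro eq_matI) auto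
  then have eq: "v - cmat X *\<^sub>v v = z \<cdot>\<^sub>v v"
    using v cX by (simp add: minus_mult_distrib_mat_vec[of _ n n])
  have "cmat X *\<^sub>v v = (1 - z) \<cdot>\<^sub>v v"
  proof (rule eq_vecI)
    fix i assume "i < dim_vec ((1 - z) \<cdot>\<^sub>v v)"
    then show "(cmat X *\<^sub>v v) $ i = ((1 - z) \<cdot>\<^sub>v v) $ i"
      using arg_cong[OF eq, of "\<lambda>u. u $ i"] v X by (simp add: algebra_simps)
  qed (use v X in simp)
  then show ?thesis using v X unfolding eigenvalue_def eigenvector_def by auto
qed

subsection \<open>Property C and bounded powers\<close>

lemma kernel_dim_cong:
  assumes "mat_kernel A = mat_kernel B" "dim_col A = dim_col B"
  shows "kernel_dim A = kernel_dim B"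
  unfolding kernel_dim_def using assms by simp

lemma cmat_row_eq_0_iff:
  assumes C: "C \<in> carrier_mat nr nc" and i: "i < nr"
  shows "row (cmat C) i = 0\<^sub>v nc \<longleftrightarrow> row C i = 0\<^sub>v nc"
  using assms by (auto simp: vec_eq_iff)

text \<open>The rank does not change under field extension because the reduced row echelon form does not.\<close>

lemma kernel_dim_cmat:
  assumes A: "A \<in> carrier_mat nr nc"
  shows "kernel_dim (cmat A) = kernel_dim A"
proof -
  define C where "C = gauss_jordan_single A"
  note gj = gauss_jordan_single[OF A C_def[symmetric]]
  from gj(4) obtain P Q where PQ: "C = P * A" "P \<in> carrier_mat nr nr" "Q \<in> carrier_mat nr nr" "Q * P = 1\<^sub>m nr"
    by blast
  have C: "C \<in> carrier_mat nr nc" by (rule gj(2))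
  have kA: "mat_kernel C = mat_kernel A"
    unfolding PQ(1) by (rule mat_kernel_mult_eq[OF A PQ(2,3,4)])
  have "cmat C = cmat P * cmat A"
    unfolding PQ(1) by (rule of_real_hom.mat_hom_mult[OF PQ(2) A])
  moreover have "cmat Q * cmat P = 1\<^sub>m nr"
    using of_real_hom.mat_hom_mult[OF PQ(3,2), symmetric] PQ(4)
    by (simp add: of_real_hom.mat_hom_one)
  ultimately have kcA: "mat_kernel (cmat C) = mat_kernel (cmat A)"
    using mat_kernel_mult_eq[of "cmat A" nr nc "cmat P" "cmat Q"] A PQ by simp
  have ref: "row_echelon_form C" by (rule gj(3))
  then obtain f where f: "pivot_fun C f nc" unfolding row_echelon_form_def using C by auto
  \<comment> \<open>The pivot conditions speak of entries being 0 or 1 only, so the same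
    \<open>f\<close> serves over the complex numbers.\<close>
  have "pivot_fun (cmat C) f nc"
    unfolding pivot_fun_def Let_def
  proof (intro allI impI)
    fix i assume "i < dim_row (cmat C)"
    then have i: "i < nr" using C by simp
    note pf = pivot_funD[OF carrier_matD(1)[OF C] f i]
    show "f i \<le> nc \<and>
      (f i < nc \<longrightarrow> cmat C $$ (i, f i) = 1 \<and>
        (\<forall>i'<dim_row (cmat C). i' \<noteq> i \<longrightarrow> cmat C $$ (i', f i) = 0)) \<and>
      (\<forall>j<f i. cmat C $$ (i, j) = 0) \<and>
      (Suc i < dim_row (cmat C) \<longrightarrow> f i < f (Suc i) \<or> f (Suc i) = nc)"
      using pf C i by auto
  qed
  then have ref': "row_echelon_form (cmat C)" unfolding row_echelon_form_def using C by auto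
  have cC: "cmat C \<in> carrier_mat nr nc" using C by simp
  have "kernel_dim (cmat A) = kernel_dim (cmat C)"
    by (rule kernel_dim_cong) (use kcA A C in auto)
  also have "\<dots> = nc - card {i. i < nr \<and> row (cmat C) i \<noteq> 0\<^sub>v nc}"
    unfolding kernel_dim_def carrier_matD(2)[OF cC] by (rule find_base_vectors(6)[OF ref' cC])
  also have "{i. i < nr \<and> row (cmat C) i \<noteq> 0\<^sub>v nc} = {i. i < nr \<and> row C i \<noteq> 0\<^sub>v nc}"
    using cmat_row_eq_0_iff[OF C] by auto
  also have "nc - card \<dots> = kernel_dim C"
    unfolding kernel_dim_def carrier_matD(2)[OF C] by (rule find_base_vectors(6)[OF ref C, symmetric])
  also have "\<dots> = kernel_dim A"
    by (rule kernel_dim_cong) (use kA A C in auto)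
  finally show ?thesis .
qed

text \<open>Property C is stated for the real matrix, whereas Jordan forms are taken over the
  complex numbers. Together with \<open>kernel_dim_cmat\<close> this carries both multiplicities
  across.\<close>

lemma order_char_poly_cmat:
  assumes A: "A \<in> carrier_mat n n"
  shows "algebraic_mult (cmat A) (of_real x) = algebraic_mult A x"
proof -
  interpret map_poly_inj_idom_divide_hom "of_real :: real \<Rightarrow> complex" ..
  show ?thesis unfolding of_real_hom.char_poly_hom[OF A] by (rule order_hom)
qed

section \<open>Jordan block sizes read off from kernel dimensions\<close>

lemma sum_list_map_eq_imp_eq:
  fixes f g :: "'a \<Rightarrow> nat"
  assumes "\<And>x. x \<in> set xs \<Longrightarrow> g x \<le> f x" "sum_list (map f xs) \<le> sum_list (map g xs)" "x \<in> set xs"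
  shows "f x = g x"
  using assms
proof (induction xs)
  case (Cons y ys)
  have "sum_list (map g ys) \<le> sum_list (map f ys)"
    using Cons.prems(1) by (intro sum_list_mono) auto
  with Cons show ?case by (cases "x = y") force+
qed simp

text \<open>The algebraic multiplicity adds up the sizes of the blocks for \<open>z\<close>, the
  geometric one adds 1 for each block. If the first sum does not exceed the second, the two agree
  block by block.\<close>

lemma semisimple_jordan_blocks:
  fixes A :: "complex mat"
  assumes jnf: "jordan_nf A n_as" and le: "algebraic_mult A z \<le> dim_gen_eigenspace A z 1"
    and mem: "(m, z) \<in> set n_as"
  shows "m \<le> 1"
proof -
  let ?bs = "[(m, e)\<leftarrow>n_as. e = z]"
  have eq: "filter (\<lambda>na. snd na = z) n_as = ?bs" by (rule filter_cong) auto
  have "sum_list (map fst ?bs) \<le> sum_list (map (\<lambda>b. min 1 (fst b)) ?bs)"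
    using le unfolding jordan_nf_order[OF jnf] dim_gen_eigenspace[OF jnf] eq
    by (simp add: comp_def)
  moreover have "(m, z) \<in> set ?bs" using mem by simp
  ultimately have "fst (m, z) = min 1 (fst (m, z))"
    by (intro sum_list_map_eq_imp_eq[where xs = ?bs]) auto
  then show ?thesis by simp
qed

text \<open>The left side involves kernels only, so the block condition can be moved between I - N
  and N although their Jordan forms are chosen independently.\<close>

lemma jordan_blocks_le_1_iff:
  fixes A :: "complex mat"
  assumes jnf: "jordan_nf A n_as"
  shows "dim_gen_eigenspace A z 2 = dim_gen_eigenspace A z 1 \<longleftrightarrow> (\<forall>m. (m, z) \<in> set n_as \<longrightarrow> m \<le> 1)"
proof -
  let ?bs = "map fst [(m, e)\<leftarrow>n_as. e = z]"
  have "dim_gen_eigenspace A z 2 = dim_gen_eigenspace A z 1 \<longleftrightarrow> (\<forall>m\<in>set ?bs. m \<le> 1)"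
    unfolding dim_gen_eigenspace[OF jnf]
  proof
    assume eq: "sum_list (map (min 2) ?bs) = sum_list (map (min 1) ?bs)"
    show "\<forall>m\<in>set ?bs. m \<le> 1"
    proof
      fix m assume "m \<in> set ?bs"
      with eq have "min 2 m = min 1 m" by (intro sum_list_map_eq_imp_eq[where xs = ?bs]) auto
      then show "m \<le> 1" by simp
    qed
  next
    assume "\<forall>m\<in>set ?bs. m \<le> 1"
    then show "sum_list (map (min 2) ?bs) = sum_list (map (min 1) ?bs)"
      by (intro arg_cong[of _ _ sum_list] map_cong) auto
  qed
  also have "\<dots> \<longleftrightarrow> (\<forall>m. (m, z) \<in> set n_as \<longrightarrow> m \<le> 1)" by force
  finally show ?thesis .
qed

text \<open>The two characteristic matrices differ by a sign, which changes neither the kernel nor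
  the square. The exponents 1 and 2 are those compared in
  \<open>jordan_blocks_le_1_iff\<close>.\<close>

lemma dim_gen_eigenspace_one_minus:
  fixes W :: "complex mat"
  assumes W: "W \<in> carrier_mat n n" and k: "k = 1 \<or> k = 2"
  shows "dim_gen_eigenspace W 1 k = dim_gen_eigenspace (1\<^sub>m n - W) 0 k"
proof -
  define Z where "Z = 1\<^sub>m n - W"
  have Z: "Z \<in> carrier_mat n n" using W unfolding Z_def by (rule minus_carrier_mat)
  have c0: "char_matrix Z 0 = Z" using Z by (auto simp: char_matrix_def)
  have c1: "char_matrix W 1 = - Z"
    using W by (auto simp: char_matrix_def Z_def)
  have "mat_kernel (- Z) = mat_kernel Z"
  proof -
    have "(- Z) *\<^sub>v v = 0\<^sub>v n \<longleftrightarrow> Z *\<^sub>v v = 0\<^sub>v n" if "v \<in> carrier_vec n" for v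
    proof -
      have "(- Z) *\<^sub>v v = - (Z *\<^sub>v v)" using Z that by (simp add: uminus_mult_mat_vec)
      then show ?thesis using Z that by (auto simp: vec_eq_iff)
    qed
    then show ?thesis using Z by (auto simp: mat_kernel_def)
  qed
  moreover have "(- Z) * (- Z) = Z * Z" using Z by simp
  ultimately have "mat_kernel (char_matrix W 1 ^\<^sub>m k) = mat_kernel (char_matrix Z 0 ^\<^sub>m k)"
    using k Z by (auto simp: c0 c1 numeral_2_eq_2)
  then have "kernel_dim (char_matrix W 1 ^\<^sub>m k) = kernel_dim (char_matrix Z 0 ^\<^sub>m k)"
    using Z W by (intro kernel_dim_cong) (auto simp: c0 c1)
  then show ?thesis unfolding Z_def dim_gen_eigenspace_def .
qed

lemma det_cmat: "A \<in> carrier_mat n n \<Longrightarrow> det (cmat A) = of_real (det A)"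
  by (simp add: of_real_hom.hom_det)

lemma eigenvalue_1_imp_det_0:
  fixes N :: "real mat"
  assumes N: "N \<in> carrier_mat n n" and ev: "eigenvalue (cmat N) 1"
  shows "det (1\<^sub>m n - N) = 0"
proof -
  have cN: "cmat N \<in> carrier_mat n n" using N by simp
  obtain v where v: "v \<in> carrier_vec n" "v \<noteq> 0\<^sub>v n" "cmat N *\<^sub>v v = v"
    using ev N unfolding eigenvalue_def eigenvector_def by auto
  have "cmat (1\<^sub>m n - N) = 1\<^sub>m n - cmat N" using N by auto
  then have "cmat (1\<^sub>m n - N) *\<^sub>v v = 0\<^sub>v n"
    using v cN by (simp add: minus_mult_distrib_mat_vec[of _ n n])
  then have "det (cmat (1\<^sub>m n - N)) = 0"
    using v N by (subst det_0_iff_vec_prod_zero[of _ n]) auto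
  then show ?thesis using N by (simp add: det_cmat[of _ n])
qed

lemma jordan_block_eigenvalue:
  fixes A :: "complex mat"
  assumes A: "A \<in> carrier_mat n n" and jnf: "jordan_nf A n_as"
    and mem: "(m, z) \<in> set n_as" "m > 0"
  shows "eigenvalue A z"
proof -
  have "algebraic_mult A z > 0"
    using jordan_nf_block_size_order_bound[OF jnf mem(1)] mem(2) by simp
  then show ?thesis using A by (metis eigenvalue_root_char_poly order_root less_numeral_extra(3))
qed

lemma property_C_power_bounded:
  fixes N :: "real mat"
  assumes N: "N \<in> carrier_mat n n" and nn: "0\<^sub>m n n \<le> N" and rho: "rho N \<le> 1"
    and diag: "\<And>i. i < n \<Longrightarrow> N $$ (i, i) > 0"
    and C: "property_C (1\<^sub>m n - N)"
  shows "\<exists>c. \<forall>k. norm_bound (cmat N ^\<^sub>m k) c"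
proof -
  define A where "A = 1\<^sub>m n - N"
  have A: "A \<in> carrier_mat n n" and cN: "cmat N \<in> carrier_mat n n" and cA: "cmat A \<in> carrier_mat n n"
    using N by (auto simp: A_def)
  obtain n_as where jN: "jordan_nf (cmat N) n_as"
    using jordan_nf_exists[OF cN] char_poly_factorized[OF cN] by blast
  obtain m_as where jA: "jordan_nf (cmat A) m_as"
    using jordan_nf_exists[OF cA] char_poly_factorized[OF cA] by blast
  have blk: "m \<le> 1" if mem: "(m, z) \<in> set n_as" and z: "cmod z = 1" for m z
  proof (cases "m = 0")
    case False
    then have ev: "eigenvalue (cmat N) z" using jordan_block_eigenvalue[OF cN jN mem] by simp
    then have z1: "z = 1" using peripheral_eigenvalue_pos_diag[OF N nn rho diag _ z] by blast
    from ev have "det A = 0" unfolding z1 A_def by (rule eigenvalue_1_imp_det_0[OF N])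
    with C have ss: "semisimple_eigenvalue A 0" by (simp add: property_C_def A_def)
    have "char_matrix A 0 = A" "char_matrix (cmat A) 0 = cmat A"
      using A by (auto simp: char_matrix_def)
    then have "algebraic_mult (cmat A) 0 \<le> dim_gen_eigenspace (cmat A) 0 1"
      using ss order_char_poly_cmat[OF A, of 0] kernel_dim_cmat[OF A] cA
      by (simp add: semisimple_eigenvalue_def dim_gen_eigenspace_def)
    then have "dim_gen_eigenspace (cmat A) 0 2 = dim_gen_eigenspace (cmat A) 0 1"
      using semisimple_jordan_blocks[OF jA] jordan_blocks_le_1_iff[OF jA] by blast
    moreover have "cmat A = 1\<^sub>m n - cmat N" using N by (auto simp: A_def)
    ultimately have "dim_gen_eigenspace (cmat N) 1 2 = dim_gen_eigenspace (cmat N) 1 1"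
      using dim_gen_eigenspace_one_minus[OF cN] by simp
    then show ?thesis using jordan_blocks_le_1_iff[OF jN] mem z1 by blast
  qed simp
  \<comment> \<open>The general bound has degree one less than the largest block on the unit circle.
    With blocks of size at most 1 the exponent \<open>1 - 1\<close> makes it a constant.\<close>
  have "\<exists>c1 c2. \<forall>k. norm_bound (cmat N ^\<^sub>m k) (c1 + c2 * real k ^ (1 - 1))"
  proof (rule jordan_nf_matrix_poly_bound[OF cN _ _ jN])
    show "cmod z \<le> 1" if "(m, z) \<in> set n_as" "m > 0" for m z
      by (rule eigenvalue_cmat_norm_le_1[OF N rho jordan_block_eigenvalue[OF cN jN that]])
  qed (rule blk)
  then show ?thesis by auto
qed

subsection \<open>Polynomials in a matrix\<close>

lemma poly_mat_carrier [simp]: "A \<in> carrier_mat n n \<Longrightarrow> poly_mat p A \<in> carrier_mat n n"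
  by (simp add: poly_mat_def)

lemma poly_mat_dim [simp]:
  "dim_row (poly_mat p A) = dim_row A" "dim_col (poly_mat p A) = dim_row A"
  by (simp_all add: poly_mat_def)

text \<open>A freely chosen upper index lets polynomials of different degree be summed over one
  range.\<close>

lemma poly_mat_index:
  assumes A: "A \<in> carrier_mat n n" and ij: "i < n" "j < n" and m: "degree p \<le> m"
  shows "poly_mat p A $$ (i, j) = (\<Sum>k\<le>m. coeff p k * (A ^\<^sub>m k) $$ (i, j))"
proof -
  have "poly_mat p A $$ (i, j) = (\<Sum>k\<le>degree p. coeff p k * (A ^\<^sub>m k) $$ (i, j))"
    using A ij by (simp add: poly_mat_def)
  also have "\<dots> = (\<Sum>k\<le>m. coeff p k * (A ^\<^sub>m k) $$ (i, j))"
    using m by (intro sum.mono_neutral_left) (auto simp: coeff_eq_0)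
  finally show ?thesis .
qed

lemma poly_mat_0: "A \<in> carrier_mat n n \<Longrightarrow> poly_mat 0 A = 0\<^sub>m n n"
  by (auto simp: poly_mat_def)

lemma poly_mat_add:
  assumes A: "A \<in> carrier_mat n n"
  shows "poly_mat (p + q) A = poly_mat p A + poly_mat q A"
proof (rule eq_matI)
  fix i j assume "i < dim_row (poly_mat p A + poly_mat q A)" "j < dim_col (poly_mat p A + poly_mat q A)"
  then have ij: "i < n" "j < n" using A by (auto simp: poly_mat_def)
  let ?m = "max (degree p) (degree q)"
  show "poly_mat (p + q) A $$ (i, j) = (poly_mat p A + poly_mat q A) $$ (i, j)"
    using carrier_matD[OF A] ij
    by (simp add: poly_mat_index[OF A ij, of _ ?m] degree_add_le_max sum.distrib distrib_right)
qed (use A in \<open>auto simp: poly_mat_def\<close>)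

lemma poly_mat_smult:
  assumes A: "A \<in> carrier_mat n n"
  shows "poly_mat (Polynomial.smult c p) A = c \<cdot>\<^sub>m poly_mat p A"
proof (rule eq_matI)
  fix i j assume "i < dim_row (c \<cdot>\<^sub>m poly_mat p A)" "j < dim_col (c \<cdot>\<^sub>m poly_mat p A)"
  then have ij: "i < n" "j < n" using A by (auto simp: poly_mat_def)
  show "poly_mat (Polynomial.smult c p) A $$ (i, j) = (c \<cdot>\<^sub>m poly_mat p A) $$ (i, j)"
    using carrier_matD[OF A] ij
    by (simp add: poly_mat_index[OF A ij, of _ "degree p"] degree_smult_le sum_distrib_left mult.assoc)
qed (use A in \<open>auto simp: poly_mat_def\<close>)

lemma poly_mat_diff:
  assumes A: "A \<in> carrier_mat n n"
  shows "poly_mat (p - q) A = poly_mat p A - poly_mat q A"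
proof -
  have "p - q = p + Polynomial.smult (- 1) q" by simp
  then have "poly_mat (p - q) A = poly_mat p A + (- 1) \<cdot>\<^sub>m poly_mat q A"
    using poly_mat_add[OF A] poly_mat_smult[OF A] by metis
  then show ?thesis
    using poly_mat_carrier[OF A, of p] poly_mat_carrier[OF A, of q] by (auto intro!: eq_matI)
qed

text \<open>Horner's rule: it reduces commutation, multiplicativity and the action on eigenvectors
  to inductions over the coefficient list.\<close>

lemma poly_mat_pCons:
  assumes A: "A \<in> carrier_mat n n"
  shows "poly_mat (pCons a p) A = a \<cdot>\<^sub>m 1\<^sub>m n + poly_mat p A * A"
proof (rule eq_matI)
  note P = poly_mat_carrier[OF A, of p]
  fix i j assume "i < dim_row (a \<cdot>\<^sub>m 1\<^sub>m n + poly_mat p A * A)" "j < dim_col (a \<cdot>\<^sub>m 1\<^sub>m n + poly_mat p A * A)"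
  then have ij: "i < n" "j < n" using A by auto
  have "poly_mat (pCons a p) A $$ (i, j)
      = (\<Sum>k\<le>Suc (degree p). coeff (pCons a p) k * (A ^\<^sub>m k) $$ (i, j))"
    by (rule poly_mat_index[OF A ij degree_pCons_le])
  also have "\<dots> = a * 1\<^sub>m n $$ (i, j) + (\<Sum>k\<le>degree p. coeff p k * (A ^\<^sub>m Suc k) $$ (i, j))"
    using A by (subst sum.atMost_Suc_shift) simp
  also have "(\<Sum>k\<le>degree p. coeff p k * (A ^\<^sub>m Suc k) $$ (i, j))
      = (\<Sum>k\<le>degree p. \<Sum>l<n. coeff p k * (A ^\<^sub>m k) $$ (i, l) * A $$ (l, j))"
  proof (intro sum.cong refl)
    fix k
    have "(A ^\<^sub>m Suc k) $$ (i, j) = (\<Sum>l<n. (A ^\<^sub>m k) $$ (i, l) * A $$ (l, j))"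
      unfolding pow_mat.simps by (rule mult_mat_index[OF pow_carrier_mat[OF A] A ij])
    then show "coeff p k * (A ^\<^sub>m Suc k) $$ (i, j)
        = (\<Sum>l<n. coeff p k * (A ^\<^sub>m k) $$ (i, l) * A $$ (l, j))"
      by (simp only: sum_distrib_left mult.assoc)
  qed
  also have "\<dots> = (\<Sum>l<n. poly_mat p A $$ (i, l) * A $$ (l, j))"
    using ij by (subst sum.swap) (simp add: poly_mat_index[OF A _ _ order_refl] sum_distrib_right)
  also have "\<dots> = (poly_mat p A * A) $$ (i, j)"
    by (rule mult_mat_index[OF P A ij, symmetric])
  finally show "poly_mat (pCons a p) A $$ (i, j) = (a \<cdot>\<^sub>m 1\<^sub>m n + poly_mat p A * A) $$ (i, j)"
    using ij A P by simp
qed (use A in \<open>auto simp: poly_mat_def\<close>)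

lemma poly_mat_commute:
  assumes A: "A \<in> carrier_mat n n"
  shows "A * poly_mat p A = poly_mat p A * A"
proof (induction p)
  case 0
  then show ?case using A by (simp add: poly_mat_0[OF A])
next
  case (pCons a p)
  note P = poly_mat_carrier[OF A, of p]
  have "A * (a \<cdot>\<^sub>m 1\<^sub>m n + poly_mat p A * A) = a \<cdot>\<^sub>m A + A * (poly_mat p A * A)"
    using A P by (subst mult_add_distrib_mat[OF A]) auto
  also have "A * (poly_mat p A * A) = (poly_mat p A * A) * A"
    unfolding assoc_mult_mat[OF A P A, symmetric] pCons.IH ..
  also have "a \<cdot>\<^sub>m A + poly_mat p A * A * A = (a \<cdot>\<^sub>m 1\<^sub>m n + poly_mat p A * A) * A"
    using A P by (subst add_mult_distrib_mat[of _ n n _ A]) auto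
  finally show ?case by (simp add: poly_mat_pCons[OF A])
qed

lemma poly_mat_mult:
  assumes A: "A \<in> carrier_mat n n"
  shows "poly_mat (p * q) A = poly_mat p A * poly_mat q A"
proof (induction p)
  case 0
  then show ?case using left_mult_zero_mat[OF poly_mat_carrier[OF A, of q]] by (simp add: poly_mat_0[OF A])
next
  case (pCons a p)
  note P = poly_mat_carrier[OF A, of p] and Q = poly_mat_carrier[OF A, of q]
  have "poly_mat (pCons a p * q) A = poly_mat (Polynomial.smult a q + pCons 0 (p * q)) A"
    by simp
  also have "\<dots> = a \<cdot>\<^sub>m poly_mat q A + (0 \<cdot>\<^sub>m 1\<^sub>m n + poly_mat p A * poly_mat q A * A)"
    by (simp only: poly_mat_add[OF A] poly_mat_smult[OF A] poly_mat_pCons[OF A] pCons.IH)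
  also have "0 \<cdot>\<^sub>m 1\<^sub>m n + poly_mat p A * poly_mat q A * A = poly_mat p A * poly_mat q A * A"
    using A P Q by (auto intro!: eq_matI)
  also have "\<dots> = poly_mat p A * A * poly_mat q A"
    unfolding assoc_mult_mat[OF P Q A] assoc_mult_mat[OF P A Q] poly_mat_commute[OF A] ..
  also have "a \<cdot>\<^sub>m poly_mat q A + \<dots> = (a \<cdot>\<^sub>m 1\<^sub>m n + poly_mat p A * A) * poly_mat q A"
    using A P Q by (subst add_mult_distrib_mat[of _ n n]) auto
  finally show ?case by (simp add: poly_mat_pCons[OF A])
qed

lemma poly_mat_const:
  assumes A: "A \<in> carrier_mat n n"
  shows "poly_mat [:a:] A = a \<cdot>\<^sub>m 1\<^sub>m n"
  using poly_mat_pCons[OF A, of a 0] A by (simp add: poly_mat_0[OF A])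

lemma poly_mat_linear:
  assumes A: "A \<in> carrier_mat n n"
  shows "poly_mat [:a, b:] A = a \<cdot>\<^sub>m 1\<^sub>m n + b \<cdot>\<^sub>m A"
proof -
  have "b \<cdot>\<^sub>m 1\<^sub>m n * A = b \<cdot>\<^sub>m A"
    using mult_smult_assoc_mat[OF one_carrier_mat A, of b] A by simp
  then show ?thesis using poly_mat_pCons[OF A, of a "[:b:]"] by (simp add: poly_mat_const[OF A])
qed

lemma poly_mat_mult_vec_commute:
  assumes A: "A \<in> carrier_mat n n" and v: "v \<in> carrier_vec n"
  shows "poly_mat p A *\<^sub>v (poly_mat q A *\<^sub>v v) = poly_mat q A *\<^sub>v (poly_mat p A *\<^sub>v v)"
  using poly_mat_mult[OF A, of p q] poly_mat_mult[OF A, of q p]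
    assoc_mult_mat_vec[OF poly_mat_carrier[OF A] poly_mat_carrier[OF A] v]
  by (metis mult.commute)

lemma poly_mat_id: "A \<in> carrier_mat n n \<Longrightarrow> poly_mat [:0, 1:] A = A"
  by (simp add: poly_mat_linear[of A n]) (auto intro!: eq_matI)

lemma poly_mat_eigenvector:
  assumes A: "A \<in> carrier_mat n n" and v: "v \<in> carrier_vec n" and Av: "A *\<^sub>v v = z \<cdot>\<^sub>v v"
  shows "poly_mat p A *\<^sub>v v = poly p z \<cdot>\<^sub>v v"
proof (induction p)
  case 0
  then show ?case using v by (auto intro!: eq_vecI simp: poly_mat_0[OF A])
next
  case (pCons a p)
  note P = poly_mat_carrier[OF A, of p]
  have "poly_mat (pCons a p) A *\<^sub>v v = a \<cdot>\<^sub>v v + poly_mat p A *\<^sub>v (A *\<^sub>v v)"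
    unfolding poly_mat_pCons[OF A]
    using A P v by (subst add_mult_distrib_mat_vec[of _ n n]) (auto simp: assoc_mult_mat_vec[of _ n n])
  also have "poly_mat p A *\<^sub>v (A *\<^sub>v v) = z \<cdot>\<^sub>v (poly p z \<cdot>\<^sub>v v)"
    unfolding Av pCons.IH[symmetric] by (rule mult_mat_vec[OF P v])
  also have "a \<cdot>\<^sub>v v + z \<cdot>\<^sub>v (poly p z \<cdot>\<^sub>v v) = poly (pCons a p) z \<cdot>\<^sub>v v"
    using v by (auto intro!: eq_vecI simp: algebra_simps)
  finally show ?case .
qed

text \<open>The induction eliminates one coordinate at a time: if some \<open>s\<close> in the subspace does not
  vanish at \<open>a\<close>, subtracting multiples of \<open>s\<close> moves the sequence into the subspace of functions
  vanishing at \<open>a\<close>.\<close>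

lemma subspace_closed_pointwise:
  fixes V :: "('i \<Rightarrow> complex) set"
  assumes "finite I"
    and "\<And>f g. f \<in> V \<Longrightarrow> g \<in> V \<Longrightarrow> (\<lambda>i. f i + g i) \<in> V"
    and "\<And>c f. f \<in> V \<Longrightarrow> (\<lambda>i. c * f i) \<in> V"
    and "\<And>k. f k \<in> V" and "\<And>i. i \<in> I \<Longrightarrow> (\<lambda>k. f k i) \<longlonglongrightarrow> g i"
  shows "\<exists>h \<in> V. \<forall>i\<in>I. h i = g i"
  using assms
proof (induction I arbitrary: V f g rule: finite_induct)
  case empty
  then show ?case by blast
next
  case (insert a I)
  note add = insert.prems(1) and scale = insert.prems(2) and fV = insert.prems(3) and lim = insert.prems(4)
  show ?case
  proof (cases "\<exists>s\<in>V. s a \<noteq> 0")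
    case True
    then obtain s where s: "s \<in> V" "s a \<noteq> 0" by blast
    define f' where "f' = (\<lambda>k i. f k i + (- (f k a / s a)) * s i)"
    define g' where "g' = (\<lambda>i. g i + (- (g a / s a)) * s i)"
    have "\<exists>h \<in> {v \<in> V. v a = 0}. \<forall>i\<in>I. h i = g' i"
    proof (rule insert.IH[where f = f'])
      show "f' k \<in> {v \<in> V. v a = 0}" for k
      proof -
        have "f' k \<in> V" unfolding f'_def by (rule add[OF fV scale[OF s(1)]])
        then show ?thesis using s(2) by (simp add: f'_def)
      qed
      show "(\<lambda>k. f' k i) \<longlonglongrightarrow> g' i" if "i \<in> I" for i
        unfolding f'_def g'_def using lim that s(2) by (intro tendsto_intros) auto
    qed (use add scale in auto)
    then obtain h where h: "h \<in> V" "h a = 0" "\<And>i. i \<in> I \<Longrightarrow> h i = g' i" by blast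
    have "(\<lambda>i. h i + (g a / s a) * s i) \<in> V" using add[OF h(1) scale[OF s(1)]] .
    moreover have "\<forall>i\<in>insert a I. h i + (g a / s a) * s i = g i"
      using h s by (auto simp: g'_def)
    ultimately show ?thesis by (rule bexI[where x = "\<lambda>i. h i + (g a / s a) * s i", rotated])
  next
    case False
    then have zero: "v a = 0" if "v \<in> V" for v using that by blast
    have "(\<lambda>k. f k a) = (\<lambda>_. 0)" using zero fV by auto
    with lim[of a] have "g a = 0" by (simp add: LIMSEQ_const_iff)
    moreover have "\<exists>h\<in>V. \<forall>i\<in>I. h i = g i"
      by (rule insert.IH[where f = f, OF add scale fV]) (use lim in simp_all)
    ultimately show ?thesis using zero by simp
  qed
qed

lemma poly_mat_limit:
  assumes A: "A \<in> carrier_mat n n" and G: "G \<in> carrier_mat n n"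
    and lim: "\<And>i j. i < n \<Longrightarrow> j < n \<Longrightarrow> (\<lambda>k. poly_mat (p k) A $$ (i, j)) \<longlonglongrightarrow> G $$ (i, j)"
  shows "\<exists>q. G = poly_mat q A"
proof -
  let ?I = "{..<n} \<times> {..<n}"
  \<comment> \<open>Entries outside the dimensions of a matrix are unspecified and need not respect
    sums or scaling. Cutting them off to 0 makes the family a subspace of functions.\<close>
  let ?r = "\<lambda>M ij. if ij \<in> ?I then M $$ ij else 0 :: complex"
  let ?V = "range (\<lambda>q. ?r (poly_mat q A))"
  have "\<exists>h\<in>?V. \<forall>ij\<in>?I. h ij = G $$ ij"
  proof (rule subspace_closed_pointwise[where f = "\<lambda>k. ?r (poly_mat (p k) A)"])
    fix f g assume "f \<in> ?V" "g \<in> ?V"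
    then obtain q r where f: "f = ?r (poly_mat q A)" and g: "g = ?r (poly_mat r A)" by blast
    have "(\<lambda>ij. f ij + g ij) = ?r (poly_mat (q + r) A)"
      unfolding f g poly_mat_add[OF A]
      using poly_mat_carrier[OF A, of q] poly_mat_carrier[OF A, of r] by fastforce
    then show "(\<lambda>ij. f ij + g ij) \<in> ?V" by blast
  next
    fix c f assume "f \<in> ?V"
    then obtain q where f: "f = ?r (poly_mat q A)" by blast
    have "(\<lambda>ij. c * f ij) = ?r (poly_mat (Polynomial.smult c q) A)"
      unfolding f poly_mat_smult[OF A] using poly_mat_carrier[OF A, of q] by fastforce
    then show "(\<lambda>ij. c * f ij) \<in> ?V" by blast
  qed (use lim in auto)
  then obtain q where "\<forall>ij\<in>?I. ?r (poly_mat q A) ij = G $$ ij" by blast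
  then have "G = poly_mat q A"
    using G poly_mat_carrier[OF A, of q] by (intro eq_matI) auto
  then show ?thesis by blast
qed

text \<open>The n + 1 Krylov vectors v, A v, ..., A^n v are linearly dependent. They are the columns
  of \<open>B\<close>, padded by a zero row so that a determinant can detect the dependence; the
  coefficients of \<open>r\<close> are a kernel vector of \<open>B\<close>.\<close>

lemma exists_annihilating_poly:
  assumes A: "A \<in> carrier_mat n n" and v: "v \<in> carrier_vec n"
  shows "\<exists>r. r \<noteq> 0 \<and> poly_mat r A *\<^sub>v v = 0\<^sub>v n"
proof -
  define B where "B = mat (Suc n) (Suc n) (\<lambda>(i, k). if i < n then (A ^\<^sub>m k *\<^sub>v v) $ i else 0)"
  have B: "B \<in> carrier_mat (Suc n) (Suc n)" by (simp add: B_def)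
  \<comment> \<open>The padding row of \<open>B\<close> is the last column of the transpose, so the
    last unit vector is mapped to 0.\<close>
  have "transpose_mat B *\<^sub>v unit_vec (Suc n) n = 0\<^sub>v (Suc n)"
    by (auto simp: B_def intro!: eq_vecI)
  moreover have "unit_vec (Suc n) n \<noteq> 0\<^sub>v (Suc n)" by simp
  ultimately have "det (transpose_mat B) = 0"
    using B by (subst det_0_iff_vec_prod_zero[of _ "Suc n"]) (auto intro!: exI[of _ "unit_vec (Suc n) n"])
  then have "det B = 0" using det_transpose[OF B] by simp
  then obtain c where c: "c \<in> carrier_vec (Suc n)" "c \<noteq> 0\<^sub>v (Suc n)" "B *\<^sub>v c = 0\<^sub>v (Suc n)"
    using det_0_iff_vec_prod_zero[OF B] by blast
  define r where "r = (\<Sum>k\<le>n. monom (c $ k) k)"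
  have cr: "coeff r k = (if k \<le> n then c $ k else 0)" for k
    by (simp add: r_def coeff_sum)
  have "r \<noteq> 0"
  proof
    assume "r = 0"
    then have "c $ k = 0" if "k < Suc n" for k using cr[of k] that by simp
    with c show False by (auto intro!: eq_vecI)
  qed
  moreover have "poly_mat r A *\<^sub>v v = 0\<^sub>v n"
  proof (rule eq_vecI)
    fix i assume "i < dim_vec (0\<^sub>v n)"
    then have i: "i < n" by simp
    have deg: "degree r \<le> n" by (rule degree_le) (simp add: cr)
    have "(poly_mat r A *\<^sub>v v) $ i = (\<Sum>j<n. (\<Sum>k\<le>n. coeff r k * (A ^\<^sub>m k) $$ (i, j)) * v $ j)"
      using i by (simp add: mult_mat_vec_index[OF poly_mat_carrier[OF A] v i] poly_mat_index[OF A _ _ deg])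
    also have "\<dots> = (\<Sum>k\<le>n. \<Sum>j<n. coeff r k * (A ^\<^sub>m k) $$ (i, j) * v $ j)"
      by (subst sum.swap) (simp add: sum_distrib_right)
    also have "\<dots> = (\<Sum>k\<le>n. B $$ (i, k) * c $ k)"
    proof (intro sum.cong refl)
      fix k assume k: "k \<in> {..n}"
      have "(\<Sum>j<n. coeff r k * (A ^\<^sub>m k) $$ (i, j) * v $ j) = coeff r k * (A ^\<^sub>m k *\<^sub>v v) $ i"
        by (simp add: mult_mat_vec_index[OF pow_carrier_mat[OF A] v i] sum_distrib_left mult.assoc)
      then show "(\<Sum>j<n. coeff r k * (A ^\<^sub>m k) $$ (i, j) * v $ j) = B $$ (i, k) * c $ k"
        using k i by (simp add: cr B_def)
    qed
    also have "\<dots> = (B *\<^sub>v c) $ i"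
      using i by (simp add: mult_mat_vec_index[OF B c(1)] lessThan_Suc_atMost)
    finally show "(poly_mat r A *\<^sub>v v) $ i = 0\<^sub>v n $ i" using c(3) i by simp
  qed (use carrier_matD(1)[OF poly_mat_carrier[OF A]] in simp)
  ultimately show ?thesis by blast
qed

subsection \<open>Uniqueness of the principal square root\<close>

text \<open>Once the kernels stop growing between the first and the second power, they never grow
  again. The exponent 0 fits because it forces \<open>v\<close> to vanish.\<close>

lemma ker_pow_eq_ker:
  assumes A: "A \<in> carrier_mat n n"
    and ker: "\<And>v. v \<in> carrier_vec n \<Longrightarrow> A *\<^sub>v (A *\<^sub>v v) = 0\<^sub>v n \<Longrightarrow> A *\<^sub>v v = 0\<^sub>v n"
    and v: "v \<in> carrier_vec n" and Ak: "A ^\<^sub>m k *\<^sub>v v = 0\<^sub>v n"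
  shows "A *\<^sub>v v = 0\<^sub>v n"
  using v Ak
proof (induction k arbitrary: v)
  case 0
  then show ?case using A by auto
next
  case (Suc k)
  have "A ^\<^sub>m k *\<^sub>v (A *\<^sub>v v) = 0\<^sub>v n"
    using Suc.prems assoc_mult_mat_vec[OF pow_carrier_mat[OF A] A Suc.prems(1)] by simp
  then have "A *\<^sub>v (A *\<^sub>v v) = 0\<^sub>v n" using A Suc by simp
  with ker Suc.prems show ?case by blast
qed

text \<open>Both square roots are polynomials in \<open>A\<close>, so their sum \<open>S\<close> and difference \<open>D\<close> satisfy
  \<open>S D = 0\<close>. An eigenvector of \<open>A\<close> in the kernel of \<open>S\<close> must belong to the eigenvalue \<open>0\<close>
  of \<open>A\<close>, because there the two roots have opposite eigenvalues in the closed right half plane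
  and hence a purely imaginary one. So \<open>A\<close> is nilpotent on the kernel of \<open>S\<close>, which
  contains the range of \<open>D\<close>.\<close>

lemma principal_sqrt_unique:
  assumes A: "A \<in> carrier_mat n n"
    and ker: "\<And>v. v \<in> carrier_vec n \<Longrightarrow> A *\<^sub>v (A *\<^sub>v v) = 0\<^sub>v n \<Longrightarrow> A *\<^sub>v v = 0\<^sub>v n"
    and real_ev: "\<And>x. eigenvalue A (complex_of_real x) \<Longrightarrow> 0 \<le> x"
    and Y: "is_principal_sqrt A Y" and Z: "is_principal_sqrt A Z"
  shows "Y = Z"
proof -
  obtain p where p: "Y = poly_mat p A" using Y by (auto simp: is_principal_sqrt_def)
  obtain q where q: "Z = poly_mat q A" using Z by (auto simp: is_principal_sqrt_def)
  have YY: "Y * Y = A" "\<And>z. eigenvalue Y z \<Longrightarrow> 0 \<le> Re z"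
    and ZZ: "Z * Z = A" "\<And>z. eigenvalue Z z \<Longrightarrow> 0 \<le> Re z"
    using Y Z by (auto simp: is_principal_sqrt_def)
  have Yc: "Y \<in> carrier_mat n n" and Zc: "Z \<in> carrier_mat n n" using A by (simp_all add: p q)
  define D S where "D = poly_mat (p - q) A" and "S = poly_mat (p + q) A"
  have Dc: "D \<in> carrier_mat n n" and Sc: "S \<in> carrier_mat n n" using A by (simp_all add: D_def S_def)
  have "S * D = poly_mat (p * p - q * q) A"
    unfolding S_def D_def poly_mat_mult[OF A, symmetric] by (simp add: algebra_simps)
  also have "\<dots> = A - A"
    using YY(1) ZZ(1) by (simp add: poly_mat_diff[OF A] poly_mat_mult[OF A] p q)
  finally have SD: "S * D = 0\<^sub>m n n" using A by simp
  have sq: "poly p z * poly p z = z" "poly q z * poly q z = z" "0 \<le> Re (poly p z)" "0 \<le> Re (poly q z)"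
    if w: "w \<in> carrier_vec n" "w \<noteq> 0\<^sub>v n" "A *\<^sub>v w = z \<cdot>\<^sub>v w" for w z
  proof -
    obtain i where i: "i < n" "w $ i \<noteq> 0" using w eq_vecI[of w "0\<^sub>v n"] by auto
    have "poly_mat (p * p) A *\<^sub>v w = z \<cdot>\<^sub>v w" "poly_mat (q * q) A *\<^sub>v w = z \<cdot>\<^sub>v w"
      using YY(1) ZZ(1) w(3) by (simp_all add: poly_mat_mult[OF A] p q)
    then have "poly (p * p) z \<cdot>\<^sub>v w = z \<cdot>\<^sub>v w" "poly (q * q) z \<cdot>\<^sub>v w = z \<cdot>\<^sub>v w"
      by (simp_all only: poly_mat_eigenvector[OF A w(1,3)])
    from this[THEN arg_cong, of "\<lambda>u. u $ i"]
    show "poly p z * poly p z = z" "poly q z * poly q z = z" using i w(1) by simp_all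
    have "eigenvector (poly_mat t A) w (poly t z)" for t
      unfolding eigenvector_def using poly_mat_eigenvector[OF A w(1,3)] w A by simp
    then show "0 \<le> Re (poly p z)" "0 \<le> Re (poly q z)"
      using YY(2) ZZ(2) unfolding p q eigenvalue_def by blast+
  qed
  have ev0: "z = 0" if w: "w \<in> carrier_vec n" "w \<noteq> 0\<^sub>v n" "A *\<^sub>v w = z \<cdot>\<^sub>v w" and Sw: "S *\<^sub>v w = 0\<^sub>v n" for w z
  proof -
    obtain i where i: "i < n" "w $ i \<noteq> 0" using w eq_vecI[of w "0\<^sub>v n"] by auto
    have "poly (p + q) z \<cdot>\<^sub>v w = 0\<^sub>v n"
      using Sw by (simp only: S_def poly_mat_eigenvector[OF A w(1,3)])
    from arg_cong[OF this, of "\<lambda>u. u $ i"] have "poly p z + poly q z = 0" using i w(1) by simp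
    then have "Re (poly p z) + Re (poly q z) = 0" by (metis plus_complex.sel(1) zero_complex.sel(1))
    with sq(3,4)[OF w] have re: "Re (poly p z) = 0" by simp
    define t where "t = Im (poly p z)"
    have "poly p z = Complex 0 t" using re by (simp add: complex_eq_iff t_def)
    then have z: "z = of_real (- (t * t))" using sq(1)[OF w] by (simp add: complex_eq_iff)
    have "eigenvalue A z" using w A unfolding eigenvalue_def eigenvector_def by auto
    with z have "0 \<le> - (t * t)" using real_ev[of "- (t * t)"] by simp
    then have "t = 0" using zero_le_square[of t] by (simp add: order_antisym)
    with z show "z = 0" by simp
  qed
  \<comment> \<open>Induction on the degree of an annihilating polynomial r = (x - z) s. Either s
    already annihilates \<open>u\<close>, or s(A) u is an eigenvector in the kernel of
    \<open>S\<close>; then z = 0 by \<open>ev0\<close>, and s annihilates A u.\<close>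
  have nil: "\<exists>k. A ^\<^sub>m k *\<^sub>v u = 0\<^sub>v n"
    if "r \<noteq> 0" "u \<in> carrier_vec n" "S *\<^sub>v u = 0\<^sub>v n" "poly_mat r A *\<^sub>v u = 0\<^sub>v n" for r u
    using that
  proof (induction "degree r" arbitrary: r u)
    case 0
    then obtain c where c: "r = [:c:]" "c \<noteq> 0" by (metis degree_eq_zeroE pCons_0_0)
    have "poly_mat r A *\<^sub>v u = c \<cdot>\<^sub>v u"
      unfolding c poly_mat_const[OF A] using 0 by auto
    with 0 have cu: "c \<cdot>\<^sub>v u = 0\<^sub>v n" by simp
    have "u = 0\<^sub>v n"
    proof (rule eq_vecI)
      fix i assume "i < dim_vec (0\<^sub>v n)"
      then show "u $ i = 0\<^sub>v n $ i" using arg_cong[OF cu, of "\<lambda>u. u $ i"] c 0 by simp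
    qed (use 0 in simp)
    then show ?case by (intro exI[of _ 0]) (use A in auto)
  next
    case (Suc d)
    then have "\<not> constant (poly r)" by (simp add: constant_degree)
    then obtain z where "poly r z = 0" using fundamental_theorem_of_algebra by blast
    then obtain s where s: "r = [:- z, 1:] * s" unfolding poly_eq_0_iff_dvd by (auto elim: dvdE)
    then have s0: "s \<noteq> 0" using Suc.prems by auto
    then have ds: "degree s = d" using Suc.hyps(2) unfolding s by (subst (asm) degree_mult_eq) auto
    define u' where "u' = poly_mat s A *\<^sub>v u"
    have u': "u' \<in> carrier_vec n" unfolding u'_def
      by (rule mult_mat_vec_carrier[OF poly_mat_carrier[OF A] Suc.prems(2)])
    have "poly_mat [:- z, 1:] A *\<^sub>v u' = 0\<^sub>v n"
      using Suc.prems(4) assoc_mult_mat_vec[OF poly_mat_carrier[OF A] poly_mat_carrier[OF A] Suc.prems(2)]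
      unfolding s u'_def poly_mat_mult[OF A] by simp
    moreover have "poly_mat [:- z, 1:] A *\<^sub>v u' = A *\<^sub>v u' - z \<cdot>\<^sub>v u'"
      unfolding poly_mat_linear[OF A] using A u'
      by (subst add_mult_distrib_mat_vec[of _ n n]) (auto intro!: eq_vecI)
    ultimately have eq0: "A *\<^sub>v u' - z \<cdot>\<^sub>v u' = 0\<^sub>v n" by simp
    have Au': "A *\<^sub>v u' = z \<cdot>\<^sub>v u'"
    proof (rule eq_vecI)
      fix i assume "i < dim_vec (z \<cdot>\<^sub>v u')"
      then show "(A *\<^sub>v u') $ i = (z \<cdot>\<^sub>v u') $ i" using arg_cong[OF eq0, of "\<lambda>u. u $ i"] u' A by simp
    qed (use A u' in simp)
    have com: "poly_mat t A *\<^sub>v (S *\<^sub>v u) = S *\<^sub>v (poly_mat t A *\<^sub>v u)" for t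
      unfolding S_def by (rule poly_mat_mult_vec_commute[OF A Suc.prems(2)])
    have zero: "poly_mat t A *\<^sub>v 0\<^sub>v n = 0\<^sub>v n" for t
      using A by (intro eq_vecI)
        (simp_all add: mult_mat_vec_index[OF poly_mat_carrier[OF A] zero_carrier_vec] del: index_mult_mat_vec)
    have Su': "S *\<^sub>v u' = 0\<^sub>v n" using com[of s] zero Suc.prems(3) by (simp add: u'_def)
    show ?case
    proof (cases "u' = 0\<^sub>v n")
      case True
      with Suc.hyps(1)[OF ds[symmetric] s0 Suc.prems(2,3)] show ?thesis by (simp add: u'_def)
    next
      case False
      then have "z = 0" using ev0 u' Au' Su' by blast
      then have "A *\<^sub>v u' = 0\<^sub>v n" using Au' u' by (auto intro!: eq_vecI)
      then have "poly_mat s A *\<^sub>v (A *\<^sub>v u) = 0\<^sub>v n"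
        using poly_mat_mult_vec_commute[OF A Suc.prems(2), of s "[:0, 1:]"] by (simp add: u'_def poly_mat_id[OF A])
      moreover have "S *\<^sub>v (A *\<^sub>v u) = 0\<^sub>v n"
        using com[of "[:0, 1:]"] zero[of "[:0, 1:]"] Suc.prems(3) by (simp add: poly_mat_id[OF A])
      ultimately obtain k where "A ^\<^sub>m k *\<^sub>v (A *\<^sub>v u) = 0\<^sub>v n"
        using Suc.hyps(1)[OF ds[symmetric] s0 mult_mat_vec_carrier[OF A Suc.prems(2)]] by blast
      then have "A ^\<^sub>m Suc k *\<^sub>v u = 0\<^sub>v n"
        using assoc_mult_mat_vec[OF pow_carrier_mat[OF A] A Suc.prems(2)] by simp
      then show ?thesis by blast
    qed
  qed
  have AD: "A *\<^sub>v (D *\<^sub>v x) = 0\<^sub>v n" if x: "x \<in> carrier_vec n" for x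
  proof -
    have Dx: "D *\<^sub>v x \<in> carrier_vec n" using Dc x by simp
    have "S *\<^sub>v (D *\<^sub>v x) = 0\<^sub>v n"
      unfolding assoc_mult_mat_vec[OF Sc Dc x, symmetric] SD using x by (auto intro!: eq_vecI)
    moreover obtain r where "r \<noteq> 0" "poly_mat r A *\<^sub>v (D *\<^sub>v x) = 0\<^sub>v n"
      using exists_annihilating_poly[OF A Dx] by blast
    ultimately show ?thesis using nil Dx ker_pow_eq_ker[OF A ker Dx] by blast
  qed
  \<comment> \<open>So far A D = 0 only. A nonzero D x is an eigenvector of \<open>A\<close> for 0,
    where both roots take the value 0; hence p - q is divisible by x and D = A E. Then A maps A E x
    to 0, and \<open>ker\<close> gives A E x = 0.\<close>
  have D0: "D *\<^sub>v x = 0\<^sub>v n" if x: "x \<in> carrier_vec n" for x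
  proof (rule ccontr)
    assume ne: "D *\<^sub>v x \<noteq> 0\<^sub>v n"
    have Dx: "D *\<^sub>v x \<in> carrier_vec n" using Dc x by simp
    have "A *\<^sub>v (D *\<^sub>v x) = 0 \<cdot>\<^sub>v (D *\<^sub>v x)" using AD[OF x] Dc x by (auto intro!: eq_vecI)
    from sq(1,2)[OF Dx ne this] have "poly (p - q) 0 = 0" by simp
    then have "[:- 0, 1:] dvd p - q" by (simp only: poly_eq_0_iff_dvd)
    then obtain e where e: "p - q = [:0, 1:] * e" by (auto elim: dvdE)
    define E where "E = poly_mat e A"
    have Ec: "E \<in> carrier_mat n n" using A by (simp add: E_def)
    have "D = A * E" unfolding D_def e poly_mat_mult[OF A] poly_mat_id[OF A] E_def ..
    then have DE: "D *\<^sub>v x = A *\<^sub>v (E *\<^sub>v x)" using assoc_mult_mat_vec[OF A Ec x] by simp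
    have "A *\<^sub>v (E *\<^sub>v x) = 0\<^sub>v n" using AD[OF x] ker Ec x unfolding DE by auto
    with ne DE show False by simp
  qed
  have DYZ: "D = Y - Z" unfolding D_def poly_mat_diff[OF A] p q ..
  show ?thesis
  proof (rule eq_matI)
    fix i j assume "i < dim_row Z" "j < dim_col Z"
    then have ij: "i < n" "j < n" using Zc by auto
    have "D $$ (i, j) = (D *\<^sub>v unit_vec n j) $ i" using ij Dc by simp
    also have "\<dots> = 0" using D0[of "unit_vec n j"] ij by simp
    finally show "Y $$ (i, j) = Z $$ (i, j)" using ij Zc by (simp add: DYZ)
  qed (use Yc Zc in auto)
qed

subsection \<open>The iteration\<close>

lemma le_mat_iff:
  assumes "A \<in> carrier_mat n m" "B \<in> carrier_mat n m"
  shows "A \<le> B \<longleftrightarrow> (\<forall>i<n. \<forall>j<m. A $$ (i, j) \<le> B $$ (i, j))"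
  using assms by (auto simp: less_eq_mat_def)

lemma nonneg_mat_iff:
  fixes A :: "real mat"
  assumes "A \<in> carrier_mat n m"
  shows "0\<^sub>m n m \<le> A \<longleftrightarrow> (\<forall>i<n. \<forall>j<m. 0 \<le> A $$ (i, j))"
  using assms by (auto simp: less_eq_mat_def)

lemma mult_mat_mono:
  fixes A B C D :: "real mat"
  assumes A: "A \<in> carrier_mat n n" "0\<^sub>m n n \<le> A" and B: "B \<in> carrier_mat n n" "A \<le> B"
    and C: "C \<in> carrier_mat n n" "0\<^sub>m n n \<le> C" and D: "D \<in> carrier_mat n n" "C \<le> D"
  shows "A * C \<le> B * D"
proof -
  have "(A * C) $$ (i, j) \<le> (B * D) $$ (i, j)" if ij: "i < n" "j < n" for i j
  proof -
    have "(\<Sum>k<n. A $$ (i, k) * C $$ (k, j)) \<le> (\<Sum>k<n. B $$ (i, k) * D $$ (k, j))"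
    proof (rule sum_mono, rule mult_mono)
      fix k assume "k \<in> {..<n}"
      then have k: "k < n" by simp
      show "A $$ (i, k) \<le> B $$ (i, k)" "C $$ (k, j) \<le> D $$ (k, j)" "0 \<le> C $$ (k, j)"
        using A B C D ij k by (simp_all add: nonneg_mat_iff le_mat_iff)
      have "0 \<le> A $$ (i, k)" using A ij k by (simp add: nonneg_mat_iff)
      then show "0 \<le> B $$ (i, k)" using \<open>A $$ (i, k) \<le> B $$ (i, k)\<close> by simp
    qed
    then show ?thesis
      unfolding mult_mat_index[OF A(1) C(1) ij] mult_mat_index[OF B(1) D(1) ij] .
  qed
  then show ?thesis
    by (subst le_mat_iff[OF mult_carrier_mat[OF A(1) C(1)] mult_carrier_mat[OF B(1) D(1)]]) blast
qed

lemma nonneg_mult_mat_vec: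
  fixes X :: "real mat"
  assumes X: "X \<in> carrier_mat n n" "0\<^sub>m n n \<le> X" and y: "y \<in> carrier_vec n" "\<And>i. i < n \<Longrightarrow> 0 \<le> y $ i"
    and i: "i < n"
  shows "0 \<le> (X *\<^sub>v y) $ i"
  unfolding mult_mat_vec_index[OF X(1) y(1) i]
  using X y i by (intro sum_nonneg mult_nonneg_nonneg) (auto simp: nonneg_mat_iff)

text \<open>Read \<open>b\<close> as a bound on the size \<open>sup\<^sub>k \<parallel>N\<^sup>k y\<parallel>\<^sub>\<infinity>\<close> of the
  nonnegative vector \<open>y\<close>.\<close>

definition nonexpansive :: "nat \<Rightarrow> real mat \<Rightarrow> real mat \<Rightarrow> bool" where
  "nonexpansive n N X \<longleftrightarrow> X \<in> carrier_mat n n \<and> 0\<^sub>m n n \<le> X \<and>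
     (\<forall>y b. y \<in> carrier_vec n \<longrightarrow> (\<forall>i<n. 0 \<le> y $ i) \<longrightarrow> (\<forall>k. \<forall>i<n. (N ^\<^sub>m k *\<^sub>v y) $ i \<le> b) \<longrightarrow>
        (\<forall>k. \<forall>i<n. (N ^\<^sub>m k *\<^sub>v (X *\<^sub>v y)) $ i \<le> b))"

lemma nonexpansiveI:
  assumes "X \<in> carrier_mat n n" "0\<^sub>m n n \<le> X"
    and "\<And>y b k i. y \<in> carrier_vec n \<Longrightarrow> (\<And>i. i < n \<Longrightarrow> 0 \<le> y $ i) \<Longrightarrow>
      (\<And>k i. i < n \<Longrightarrow> (N ^\<^sub>m k *\<^sub>v y) $ i \<le> b) \<Longrightarrow> i < n \<Longrightarrow> (N ^\<^sub>m k *\<^sub>v (X *\<^sub>v y)) $ i \<le> b"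
  shows "nonexpansive n N X"
  using assms unfolding nonexpansive_def by blast

lemma nonexpansiveD:
  assumes "nonexpansive n N X"
  shows "X \<in> carrier_mat n n" "0\<^sub>m n n \<le> X"
    and "\<lbrakk>y \<in> carrier_vec n; \<And>i. i < n \<Longrightarrow> 0 \<le> y $ i;
      \<And>k i. i < n \<Longrightarrow> (N ^\<^sub>m k *\<^sub>v y) $ i \<le> b; i < n\<rbrakk> \<Longrightarrow> (N ^\<^sub>m k *\<^sub>v (X *\<^sub>v y)) $ i \<le> b"
  using assms unfolding nonexpansive_def by blast+

lemma nonexpansive_mult:
  assumes X: "nonexpansive n N X" and Y: "nonexpansive n N Y"
  shows "nonexpansive n N (X * Y)"
proof (rule nonexpansiveI)
  note Xc = nonexpansiveD(1,2)[OF X] and Yc = nonexpansiveD(1,2)[OF Y]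
  show "X * Y \<in> carrier_mat n n" "0\<^sub>m n n \<le> X * Y"
    using Xc Yc by (simp, intro nonneg_mat_mult)
  fix y b k i
  assume y: "y \<in> carrier_vec n" "\<And>i. i < n \<Longrightarrow> 0 \<le> y $ i"
    and b: "\<And>k i. i < n \<Longrightarrow> (N ^\<^sub>m k *\<^sub>v y) $ i \<le> b" and i: "i < n"
  have "(N ^\<^sub>m k *\<^sub>v (X *\<^sub>v (Y *\<^sub>v y))) $ i \<le> b"
  proof (rule nonexpansiveD(3)[OF X _ _ _ i])
    show "Y *\<^sub>v y \<in> carrier_vec n" using Yc y by simp
    show "0 \<le> (Y *\<^sub>v y) $ i" if "i < n" for i by (rule nonneg_mult_mat_vec[OF Yc y that])
    show "(N ^\<^sub>m k *\<^sub>v (Y *\<^sub>v y)) $ i \<le> b" if "i < n" for k i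
      by (rule nonexpansiveD(3)[OF Y y b that])
  qed
  then show "(N ^\<^sub>m k *\<^sub>v (X * Y *\<^sub>v y)) $ i \<le> b"
    using assoc_mult_mat_vec[OF Xc(1) Yc(1) y(1)] by simp
qed

lemma nonexpansive_one:
  assumes "N \<in> carrier_mat n n"
  shows "nonexpansive n N (1\<^sub>m n)"
  by (rule nonexpansiveI) (use assms in \<open>auto simp: nonneg_mat_iff[of _ n n]\<close>)

lemma nonexpansive_pow:
  assumes N: "N \<in> carrier_mat n n" and X: "nonexpansive n N X"
  shows "nonexpansive n N (X ^\<^sub>m k)"
proof (induction k)
  case 0
  then show ?case using nonexpansive_one[OF N] nonexpansiveD(1)[OF X] by simp
next
  case (Suc k)
  then show ?case using nonexpansive_mult[OF Suc X] by simp
qed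

text \<open>The orbit of N y is the orbit of y without its first term.\<close>

lemma nonexpansive_self:
  assumes N: "N \<in> carrier_mat n n" "0\<^sub>m n n \<le> N"
  shows "nonexpansive n N N"
proof (rule nonexpansiveI[OF N])
  fix y b k i
  assume y: "y \<in> carrier_vec n" and b: "\<And>k i. i < n \<Longrightarrow> (N ^\<^sub>m k *\<^sub>v y) $ i \<le> b" and i: "i < n"
  have "N ^\<^sub>m k *\<^sub>v (N *\<^sub>v y) = N ^\<^sub>m Suc k *\<^sub>v y"
    using assoc_mult_mat_vec[OF pow_carrier_mat[OF N(1)] N(1) y] by simp
  then show "(N ^\<^sub>m k *\<^sub>v (N *\<^sub>v y)) $ i \<le> b" using b[OF i, of "Suc k"] by simp
qed

lemma nonexpansive_zero:
  assumes N: "N \<in> carrier_mat n n"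
  shows "nonexpansive n N (0\<^sub>m n n)"
proof (rule nonexpansiveI)
  fix y b k i
  assume y: "y \<in> carrier_vec n" "\<And>i. i < n \<Longrightarrow> 0 \<le> y $ i"
    and b: "\<And>k i. i < n \<Longrightarrow> (N ^\<^sub>m k *\<^sub>v y) $ i \<le> b" and i: "i < n"
  have "0\<^sub>m n n *\<^sub>v y = 0\<^sub>v n" using y by (auto intro!: eq_vecI)
  moreover have "(N ^\<^sub>m k *\<^sub>v 0\<^sub>v n) $ i = 0"
    by (simp add: mult_mat_vec_index[OF pow_carrier_mat[OF N] zero_carrier_vec i])
  \<comment> \<open>Exponent 0 in the assumed bound, with y nonnegative, yields the inequality 0
    \<le> b that the zero vector requires.\<close>
  moreover have "y $ i \<le> b" using b[OF i, of 0] N y by simp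
  ultimately show "(N ^\<^sub>m k *\<^sub>v (0\<^sub>m n n *\<^sub>v y)) $ i \<le> b" using y(2)[OF i] by simp
qed (auto simp: nonneg_mat_iff)

lemma mult_mat_mult_vec_index:
  assumes M: "M \<in> carrier_mat n n" and X: "X \<in> carrier_mat n n" and y: "y \<in> carrier_vec n" and i: "i < n"
  shows "(M *\<^sub>v (X *\<^sub>v y)) $ i = (\<Sum>j<n. M $$ (i, j) * (\<Sum>l<n. X $$ (j, l) * y $ l))"
  by (simp add: mult_mat_vec_index[OF M mult_mat_vec_carrier[OF X y] i] mult_mat_vec_index[OF X y])

text \<open>For fixed \<open>y\<close> and \<open>b\<close> the conditions are linear inequalities
  in \<open>X\<close>, so they define a convex set. One step of the iteration is the average of a
  square and \<open>N\<close>.\<close>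

lemma nonexpansive_average:
  assumes N: "N \<in> carrier_mat n n" and X: "nonexpansive n N X" and Y: "nonexpansive n N Y"
  shows "nonexpansive n N ((1/2) \<cdot>\<^sub>m (X + Y))"
proof (rule nonexpansiveI)
  note Xc = nonexpansiveD(1,2)[OF X] and Yc = nonexpansiveD(1,2)[OF Y]
  show c: "(1/2) \<cdot>\<^sub>m (X + Y) \<in> carrier_mat n n" using Xc Yc by simp
  show "0\<^sub>m n n \<le> (1/2) \<cdot>\<^sub>m (X + Y)"
    unfolding nonneg_mat_iff[OF c] using Xc Yc by (simp add: nonneg_mat_iff)
  fix y b k i
  assume y: "y \<in> carrier_vec n" "\<And>i. i < n \<Longrightarrow> 0 \<le> y $ i"
    and b: "\<And>k i. i < n \<Longrightarrow> (N ^\<^sub>m k *\<^sub>v y) $ i \<le> b" and i: "i < n"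
  have "(N ^\<^sub>m k *\<^sub>v ((1/2) \<cdot>\<^sub>m (X + Y) *\<^sub>v y)) $ i
      = (\<Sum>j<n. (N ^\<^sub>m k) $$ (i, j) * (\<Sum>l<n. ((1/2) \<cdot>\<^sub>m (X + Y)) $$ (j, l) * y $ l))"
    by (rule mult_mat_mult_vec_index[OF pow_carrier_mat[OF N] c y(1) i])
  also have "\<dots> = (\<Sum>j<n. (N ^\<^sub>m k) $$ (i, j) * (\<Sum>l<n. (X $$ (j, l) + Y $$ (j, l)) / 2 * y $ l))"
    using Xc Yc by (intro sum.cong refl arg_cong2[of _ _ _ _ "(*)"]) simp
  also have "\<dots> = ((\<Sum>j<n. (N ^\<^sub>m k) $$ (i, j) * (\<Sum>l<n. X $$ (j, l) * y $ l))
      + (\<Sum>j<n. (N ^\<^sub>m k) $$ (i, j) * (\<Sum>l<n. Y $$ (j, l) * y $ l))) / 2"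
    by (simp add: sum_divide_distrib[symmetric] add_divide_distrib distrib_left distrib_right sum.distrib)
  also have "\<dots> = ((N ^\<^sub>m k *\<^sub>v (X *\<^sub>v y)) $ i + (N ^\<^sub>m k *\<^sub>v (Y *\<^sub>v y)) $ i) / 2"
    by (simp only: mult_mat_mult_vec_index[OF pow_carrier_mat[OF N] Xc(1) y(1) i]
      mult_mat_mult_vec_index[OF pow_carrier_mat[OF N] Yc(1) y(1) i])
  also have "\<dots> \<le> b"
    using nonexpansiveD(3)[OF X y b i, of k] nonexpansiveD(3)[OF Y y b i, of k] by simp
  finally show "(N ^\<^sub>m k *\<^sub>v ((1/2) \<cdot>\<^sub>m (X + Y) *\<^sub>v y)) $ i \<le> b" .
qed

lemma nonexpansive_limit:
  assumes N: "N \<in> carrier_mat n n" and X: "\<And>m. nonexpansive n N (X m)" and L: "mat_tendsto n X L"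
  shows "nonexpansive n N L"
proof (rule nonexpansiveI)
  show Lc: "L \<in> carrier_mat n n" using L by (simp add: mat_tendsto_def)
  have lim: "(\<lambda>m. X m $$ (i, j)) \<longlonglongrightarrow> L $$ (i, j)" if "i < n" "j < n" for i j
    using L that by (simp add: mat_tendsto_def)
  note Xc = nonexpansiveD(1,2)[OF X]
  have "0 \<le> L $$ (i, j)" if "i < n" "j < n" for i j
    by (rule LIMSEQ_le_const[OF lim[OF that]]) (use Xc that in \<open>auto simp: nonneg_mat_iff\<close>)
  then show "0\<^sub>m n n \<le> L" using nonneg_mat_iff[OF Lc] by blast
  fix y b k i
  assume y: "y \<in> carrier_vec n" "\<And>i. i < n \<Longrightarrow> 0 \<le> y $ i"
    and b: "\<And>k i. i < n \<Longrightarrow> (N ^\<^sub>m k *\<^sub>v y) $ i \<le> b" and i: "i < n"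
  have "(\<lambda>m. (N ^\<^sub>m k *\<^sub>v (X m *\<^sub>v y)) $ i) \<longlonglongrightarrow> (N ^\<^sub>m k *\<^sub>v (L *\<^sub>v y)) $ i"
    unfolding mult_mat_mult_vec_index[OF pow_carrier_mat[OF N] Xc(1) y(1) i]
      mult_mat_mult_vec_index[OF pow_carrier_mat[OF N] Lc y(1) i]
    by (intro tendsto_sum tendsto_mult tendsto_const lim) auto
  then show "(N ^\<^sub>m k *\<^sub>v (L *\<^sub>v y)) $ i \<le> b"
    by (rule LIMSEQ_le_const2) (use nonexpansiveD(3)[OF X y b i] in blast)
qed

text \<open>Tested on a unit vector, whose orbit consists of columns of powers of \<open>N\<close>;
  the exponent 0 then reads off a column of \<open>X\<close>.\<close>

lemma nonexpansive_entry_le: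
  assumes N: "N \<in> carrier_mat n n" and X: "nonexpansive n N X"
    and bound: "\<And>k i j. i < n \<Longrightarrow> j < n \<Longrightarrow> (N ^\<^sub>m k) $$ (i, j) \<le> c" and ij: "i < n" "j < n"
  shows "X $$ (i, j) \<le> c"
proof -
  have col: "(M *\<^sub>v unit_vec n j) $ i = M $$ (i, j)" if "M \<in> carrier_mat n n" "i < n" for M :: "real mat" and i
    using that ij(2) by simp
  have Xc: "X \<in> carrier_mat n n" by (rule nonexpansiveD(1)[OF X])
  have "(N ^\<^sub>m 0 *\<^sub>v (X *\<^sub>v unit_vec n j)) $ i \<le> c"
  proof (rule nonexpansiveD(3)[OF X _ _ _ ij(1)])
    show "0 \<le> (unit_vec n j :: real vec) $ i" if "i < n" for i using that ij(2) by (simp add: unit_vec_def)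
    show "(N ^\<^sub>m k *\<^sub>v unit_vec n j) $ i \<le> c" if "i < n" for k i
      using bound[OF that ij(2)] col[OF pow_carrier_mat[OF N] that] by simp
  qed simp
  then show ?thesis using N col[OF Xc ij(1)] Xc by simp
qed

text \<open>With w = (I - W) v the hypothesis says W w = w, whence W^k v = v - k w. This is
  unbounded in k unless w = 0.\<close>

lemma power_bounded_ker_square:
  assumes W: "W \<in> carrier_mat n n" and bound: "\<And>k. norm_bound (W ^\<^sub>m k) c"
    and v: "v \<in> carrier_vec n"
    and sq: "(1\<^sub>m n - W) *\<^sub>v ((1\<^sub>m n - W) *\<^sub>v v) = 0\<^sub>v n"
  shows "(1\<^sub>m n - W) *\<^sub>v v = (0\<^sub>v n :: complex vec)"
proof -
  have fix_vec: "(1\<^sub>m n - W) *\<^sub>v x = x - W *\<^sub>v x" if "x \<in> carrier_vec n" for x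
    using that W by (simp add: minus_mult_distrib_mat_vec[of _ n n])
  define w where "w = (1\<^sub>m n - W) *\<^sub>v v"
  have w: "w \<in> carrier_vec n" unfolding w_def
    by (rule mult_mat_vec_carrier[OF minus_carrier_mat[OF W] v])
  have Ww: "(W *\<^sub>v w) $ i = w $ i" if "i < n" for i
    using arg_cong[OF sq[folded w_def, unfolded fix_vec[OF w]], of "\<lambda>u. u $ i"] that w W by simp
  have Wv: "(W *\<^sub>v v) $ i = v $ i - w $ i" if "i < n" for i
    using that v W unfolding w_def fix_vec[OF v] by simp
  have "(W ^\<^sub>m k *\<^sub>v v) $ i = v $ i - of_nat k * w $ i" if "i < n" for i k
    using that
  proof (induction k arbitrary: i)
    case 0
    then show ?case using W v by simp
  next
    case (Suc k)
    have comm: "W ^\<^sub>m Suc k = W * W ^\<^sub>m k"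
      by (induction k) (use W in \<open>simp_all add: assoc_mult_mat[OF W pow_carrier_mat[OF W] W]\<close>)
    have "(W ^\<^sub>m Suc k *\<^sub>v v) $ i = (\<Sum>j<n. W $$ (i, j) * (W ^\<^sub>m k *\<^sub>v v) $ j)"
      unfolding comm assoc_mult_mat_vec[OF W pow_carrier_mat[OF W] v]
      by (rule mult_mat_vec_index[OF W mult_mat_vec_carrier[OF pow_carrier_mat[OF W] v] Suc.prems])
    also have "\<dots> = (\<Sum>j<n. W $$ (i, j) * v $ j) - of_nat k * (\<Sum>j<n. W $$ (i, j) * w $ j)"
      unfolding sum_distrib_left sum_subtractf[symmetric]
      by (intro sum.cong refl) (simp add: Suc.IH algebra_simps)
    also have "\<dots> = (W *\<^sub>v v) $ i - of_nat k * (W *\<^sub>v w) $ i"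
      by (simp only: mult_mat_vec_index[OF W v Suc.prems] mult_mat_vec_index[OF W w Suc.prems])
    finally show ?case using Ww Wv Suc.prems by (simp add: algebra_simps)
  qed note pow = this
  have "w $ i = 0" if i: "i < n" for i
  proof (rule ccontr)
    assume ne: "w $ i \<noteq> 0"
    define K where "K = cmod (v $ i) + (\<Sum>j<n. c * cmod (v $ j))"
    have "real k * cmod (w $ i) \<le> K" for k
    proof -
      have "cmod ((W ^\<^sub>m k *\<^sub>v v) $ i) \<le> (\<Sum>j<n. c * cmod (v $ j))"
        unfolding mult_mat_vec_index[OF pow_carrier_mat[OF W] v i]
      proof (rule order_trans[OF norm_sum], rule sum_mono)
        fix j assume "j \<in> {..<n}"
        then have "cmod ((W ^\<^sub>m k) $$ (i, j)) \<le> c"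
          using bound[of k] i carrier_matD[OF pow_carrier_mat[OF W, of k]] unfolding norm_bound_def by auto
        then show "cmod ((W ^\<^sub>m k) $$ (i, j) * v $ j) \<le> c * cmod (v $ j)"
          by (simp add: norm_mult mult_right_mono)
      qed
      moreover have "of_nat k * w $ i = v $ i - (W ^\<^sub>m k *\<^sub>v v) $ i"
        by (simp add: pow[OF i])
      then have "real k * cmod (w $ i) = cmod (v $ i - (W ^\<^sub>m k *\<^sub>v v) $ i)"
        by (metis norm_mult norm_of_nat)
      ultimately show ?thesis
        using norm_triangle_ineq4[of "v $ i" "(W ^\<^sub>m k *\<^sub>v v) $ i"] by (simp add: K_def)
    qed
    moreover obtain k where "K < real k * cmod (w $ i)" using ex_less_of_nat_mult[of "cmod (w $ i)" K] ne by auto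
    ultimately show False by (meson not_le)
  qed
  then have "w = 0\<^sub>v n" using w by (intro eq_vecI) auto
  then show ?thesis by (simp add: w_def)
qed

section \<open>The limit \<open>G\<close> for a nonnegative matrix with bounded powers\<close>

locale power_bounded_nonneg =
  fixes n :: nat and N :: "real mat" and c :: real
  assumes n: "n > 0" and N: "N \<in> carrier_mat n n" and N_nonneg: "0\<^sub>m n n \<le> N"
    and bound: "\<And>k. norm_bound (cmat N ^\<^sub>m k) c"
begin

lemma pow_le: "i < n \<Longrightarrow> j < n \<Longrightarrow> (N ^\<^sub>m k) $$ (i, j) \<le> c"
proof -
  assume ij: "i < n" "j < n"
  have "cmod (cmat (N ^\<^sub>m k) $$ (i, j)) \<le> c"
    using bound[of k] ij N unfolding norm_bound_def cmat_pow[OF N] by simp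
  then show ?thesis using ij N by simp
qed

lemma iter_carrier: "sqrt_iter N k \<in> carrier_mat n n"
  by (induction k) (use N in auto)

lemma iter_index:
  assumes "i < n" "j < n"
  shows "sqrt_iter N (Suc k) $$ (i, j) = ((sqrt_iter N k * sqrt_iter N k) $$ (i, j) + N $$ (i, j)) / 2"
  using assms N iter_carrier[of k] by simp

lemma nonexpansive_iter: "nonexpansive n N (sqrt_iter N k)"
proof (induction k)
  case 0
  then show ?case using nonexpansive_zero[OF N] N by simp
next
  case (Suc k)
  show ?case unfolding sqrt_iter.simps
    by (intro nonexpansive_average[OF N] nonexpansive_mult Suc nonexpansive_self N N_nonneg)
qed

lemma iter_nonneg: "0\<^sub>m n n \<le> sqrt_iter N k"
  by (rule nonexpansiveD(2)[OF nonexpansive_iter])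

text \<open>The map from X to (X^2 + N) / 2 preserves the entry-wise order on nonnegative matrices,
  and the first step starts at 0.\<close>

lemma iter_mono: "sqrt_iter N k \<le> sqrt_iter N (Suc k)"
proof (induction k)
  case 0
  then show ?case using iter_nonneg[of "Suc 0"] N by simp
next
  case (Suc k)
  note mm = mult_mat_mono[OF iter_carrier iter_nonneg iter_carrier Suc iter_carrier iter_nonneg iter_carrier Suc]
  have "sqrt_iter N (Suc k) $$ (i, j) \<le> sqrt_iter N (Suc (Suc k)) $$ (i, j)" if "i < n" "j < n" for i j
    using mm that unfolding le_mat_iff[OF mult_carrier_mat[OF iter_carrier iter_carrier] mult_carrier_mat[OF iter_carrier iter_carrier]]
      iter_index[OF that] by (auto simp del: sqrt_iter.simps)
  then show ?case using le_mat_iff[OF iter_carrier iter_carrier] by blast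
qed

text \<open>As a value of \<open>lim\<close> this becomes meaningful with the convergence shown in
  \<open>iter_tendsto_index\<close>.\<close>

definition G :: "real mat" where
  "G = mat n n (\<lambda>(i, j). lim (\<lambda>k. sqrt_iter N k $$ (i, j)))"

lemma G_carrier: "G \<in> carrier_mat n n"
  by (simp add: G_def)

lemma iter_tendsto_index:
  assumes ij: "i < n" "j < n"
  shows "(\<lambda>k. sqrt_iter N k $$ (i, j)) \<longlonglongrightarrow> G $$ (i, j)"
proof -
  have "incseq (\<lambda>k. sqrt_iter N k $$ (i, j))"
    using iter_mono ij le_mat_iff[OF iter_carrier iter_carrier] by (intro incseq_SucI) blast
  moreover have "sqrt_iter N k $$ (i, j) \<le> c" for k
    by (rule nonexpansive_entry_le[OF N nonexpansive_iter pow_le ij])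
  ultimately obtain l where "(\<lambda>k. sqrt_iter N k $$ (i, j)) \<longlonglongrightarrow> l"
    using incseq_convergent by blast
  then have "(\<lambda>k. sqrt_iter N k $$ (i, j)) \<longlonglongrightarrow> lim (\<lambda>k. sqrt_iter N k $$ (i, j))"
    by (simp add: limI)
  then show ?thesis using ij by (simp add: G_def)
qed

lemma iter_tendsto: "mat_tendsto n (sqrt_iter N) G"
  using iter_carrier G_carrier iter_tendsto_index by (simp add: mat_tendsto_def)

lemma nonexpansive_G: "nonexpansive n N G"
  by (rule nonexpansive_limit[OF N nonexpansive_iter iter_tendsto])

lemma G_nonneg: "0\<^sub>m n n \<le> G"
  by (rule nonexpansiveD(2)[OF nonexpansive_G])

text \<open>A bound on the entries of \<open>G\<close> alone would not suffice. Its powers are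
  nonexpansive as well, so all their entries lie between 0 and the same constant
  \<open>c\<close>.\<close>

lemma rho_G: "rho G \<le> 1"
proof (rule power_bounded_imp_spectral_radius_le_1[of _ n])
  show "cmat G \<in> carrier_mat n n" using G_carrier by simp
  show "norm_bound (cmat G ^\<^sub>m k) c" for k
  proof
    fix i j assume "i < dim_row (cmat G ^\<^sub>m k)" "j < dim_col (cmat G ^\<^sub>m k)"
    then have ij: "i < n" "j < n" using carrier_matD[OF pow_carrier_mat[OF G_carrier]]
      by (simp_all add: cmat_pow[OF G_carrier] del: pow_mat_dim)
    have "0 \<le> (G ^\<^sub>m k) $$ (i, j)" "(G ^\<^sub>m k) $$ (i, j) \<le> c"
      using nonneg_mat_pow[OF G_carrier G_nonneg, of k] ij
        nonexpansive_entry_le[OF N nonexpansive_pow[OF N nonexpansive_G] pow_le ij]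
      by (auto simp: nonneg_mat_iff[OF pow_carrier_mat[OF G_carrier]])
    then show "norm ((cmat G ^\<^sub>m k) $$ (i, j)) \<le> c"
      using ij G_carrier by (simp add: cmat_pow[OF G_carrier])
  qed
qed (rule n)

lemma G_fixpoint_index:
  assumes ij: "i < n" "j < n"
  shows "2 * G $$ (i, j) = (G * G) $$ (i, j) + N $$ (i, j)"
proof -
  have "(\<lambda>k. (sqrt_iter N k * sqrt_iter N k) $$ (i, j)) \<longlonglongrightarrow> (G * G) $$ (i, j)"
    unfolding mult_mat_index[OF iter_carrier iter_carrier ij] mult_mat_index[OF G_carrier G_carrier ij]
    by (intro tendsto_sum tendsto_mult iter_tendsto_index ij) auto
  then have "(\<lambda>k. sqrt_iter N (Suc k) $$ (i, j)) \<longlonglongrightarrow> ((G * G) $$ (i, j) + N $$ (i, j)) / 2"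
    unfolding iter_index[OF ij] by (intro tendsto_intros) simp_all
  moreover have "(\<lambda>k. sqrt_iter N (Suc k) $$ (i, j)) \<longlonglongrightarrow> G $$ (i, j)"
    by (rule LIMSEQ_Suc[OF iter_tendsto_index[OF ij]])
  ultimately have "G $$ (i, j) = ((G * G) $$ (i, j) + N $$ (i, j)) / 2"
    using LIMSEQ_unique by blast
  then show ?thesis by simp
qed

lemma quadratic_iff:
  assumes X: "X \<in> carrier_mat n n"
  shows "X * X - 2 \<cdot>\<^sub>m X + N = 0\<^sub>m n n \<longleftrightarrow>
    (\<forall>i<n. \<forall>j<n. 2 * X $$ (i, j) = (X * X) $$ (i, j) + N $$ (i, j))"
proof -
  have "X * X - 2 \<cdot>\<^sub>m X + N = 0\<^sub>m n n \<longleftrightarrow>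
    (\<forall>i<n. \<forall>j<n. (X * X) $$ (i, j) - 2 * X $$ (i, j) + N $$ (i, j) = 0)"
    using X N by (subst mat_eq_iff) (simp del: index_mult_mat(1))
  moreover have "b - 2 * a + m = 0 \<longleftrightarrow> 2 * a = b + m" for a b m :: real by auto
  ultimately show ?thesis by (simp only:)
qed

text \<open>A nonnegative solution is a fixed point of the monotone map behind the iteration and
  lies above the starting value 0.\<close>

lemma iter_le_solution:
  assumes Y: "Y \<in> carrier_mat n n" "0\<^sub>m n n \<le> Y" "Y * Y - 2 \<cdot>\<^sub>m Y + N = 0\<^sub>m n n"
  shows "sqrt_iter N k \<le> Y"
proof (induction k)
  case 0
  then show ?case using Y N by simp
next
  case (Suc k)
  note mm = mult_mat_mono[OF iter_carrier iter_nonneg Y(1) Suc iter_carrier iter_nonneg Y(1) Suc]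
  have "sqrt_iter N (Suc k) $$ (i, j) \<le> Y $$ (i, j)" if ij: "i < n" "j < n" for i j
  proof -
    have "(sqrt_iter N k * sqrt_iter N k) $$ (i, j) \<le> (Y * Y) $$ (i, j)"
      using mm ij unfolding le_mat_iff[OF mult_carrier_mat[OF iter_carrier iter_carrier] mult_carrier_mat[OF Y(1) Y(1)]]
      by blast
    moreover have "2 * Y $$ (i, j) = (Y * Y) $$ (i, j) + N $$ (i, j)"
      using Y(3) ij unfolding quadratic_iff[OF Y(1)] by blast
    moreover have "(a + m) / 2 \<le> y" if "a \<le> b" "2 * y = b + m" for a b m y :: real
      using that by simp
    ultimately show ?thesis unfolding iter_index[OF ij] by blast
  qed
  then show ?case using le_mat_iff[OF iter_carrier Y(1)] by blast
qed

lemma G_minimal: "minimal_nonneg_solution n (\<lambda>X. X * X - 2 \<cdot>\<^sub>m X + N = 0\<^sub>m n n) G"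
  unfolding minimal_nonneg_solution_def
proof (intro conjI ballI impI)
  show "G * G - 2 \<cdot>\<^sub>m G + N = 0\<^sub>m n n"
    using G_fixpoint_index by (simp only: quadratic_iff[OF G_carrier]) blast
  fix Y assume Y: "Y \<in> carrier_mat n n" "0\<^sub>m n n \<le> Y \<and> Y * Y - 2 \<cdot>\<^sub>m Y + N = 0\<^sub>m n n"
  have "G $$ (i, j) \<le> Y $$ (i, j)" if ij: "i < n" "j < n" for i j
    by (rule LIMSEQ_le_const2[OF iter_tendsto_index[OF ij]])
      (use iter_le_solution Y ij le_mat_iff[OF iter_carrier Y(1)] in blast)
  then show "G \<le> Y" using le_mat_iff[OF G_carrier Y(1)] by blast
qed (rule G_carrier G_nonneg)+

section \<open>\<open>1 - G\<close> as the principal square root of \<open>A\<close>\<close>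

abbreviation "A \<equiv> 1\<^sub>m n - N"

lemma A_carrier: "A \<in> carrier_mat n n" and root_carrier: "1\<^sub>m n - G \<in> carrier_mat n n"
  by (rule minus_carrier_mat[OF N], rule minus_carrier_mat[OF G_carrier])

lemma root_square: "(1\<^sub>m n - G) * (1\<^sub>m n - G) = A"
proof -
  have "(1\<^sub>m n - G) * (1\<^sub>m n - G) = (1\<^sub>m n - G) - (G - G * G)"
    using G_carrier root_carrier minus_mult_distrib_mat[OF one_carrier_mat G_carrier root_carrier]
      mult_minus_distrib_mat[OF G_carrier one_carrier_mat G_carrier] by simp
  also have "\<dots> = A"
    using G_carrier N G_fixpoint_index by (intro eq_matI) (auto simp del: index_mult_mat(1) simp: index_mult_mat(2,3))
  finally show ?thesis .
qed

text \<open>N = I - A is itself a polynomial in \<open>A\<close>, namely \<open>[:1, - 1:]\<close>,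
  and the recursion uses only squares, sums and scaling.\<close>

lemma iter_poly_mat: "\<exists>p. cmat (sqrt_iter N k) = poly_mat p (cmat A)"
proof (induction k)
  case 0
  have "cmat (sqrt_iter N 0) = poly_mat 0 (cmat A)"
    using N by (subst poly_mat_0[of _ n]) (auto simp: A_carrier)
  then show ?case by blast
next
  case (Suc k)
  then obtain p where p: "cmat (sqrt_iter N k) = poly_mat p (cmat A)" by blast
  have cA: "cmat A \<in> carrier_mat n n" using A_carrier by simp
  have lin: "poly_mat [:1, - 1:] (cmat A) = cmat N"
    unfolding poly_mat_linear[OF cA] using N by (intro eq_matI) auto
  have "cmat (sqrt_iter N (Suc k)) = (1/2) \<cdot>\<^sub>m (cmat (sqrt_iter N k * sqrt_iter N k) + cmat N)"
    using N iter_carrier[of k] by (intro eq_matI) (auto simp del: index_mult_mat(1) simp: index_mult_mat(2,3))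
  also have "cmat (sqrt_iter N k * sqrt_iter N k) = poly_mat (p * p) (cmat A)"
    unfolding of_real_hom.mat_hom_mult[OF iter_carrier iter_carrier] p poly_mat_mult[OF cA] ..
  finally have "cmat (sqrt_iter N (Suc k)) = poly_mat (Polynomial.smult (1/2) (p * p + [:1, - 1:])) (cmat A)"
    unfolding poly_mat_smult[OF cA] poly_mat_add[OF cA] lin .
  then show ?case by blast
qed

lemma root_poly_mat: "\<exists>p. cmat (1\<^sub>m n - G) = poly_mat p (cmat A)"
proof -
  have cA: "cmat A \<in> carrier_mat n n" using A_carrier by simp
  obtain p where p: "\<And>k. cmat (sqrt_iter N k) = poly_mat (p k) (cmat A)"
    using iter_poly_mat by metis
  have "\<exists>q. cmat G = poly_mat q (cmat A)"
  proof (rule poly_mat_limit[OF cA])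
    fix i j assume ij: "i < n" "j < n"
    have "(\<lambda>k. complex_of_real (sqrt_iter N k $$ (i, j))) \<longlonglongrightarrow> complex_of_real (G $$ (i, j))"
      by (intro tendsto_of_real iter_tendsto_index ij)
    moreover have "poly_mat (p k) (cmat A) $$ (i, j) = complex_of_real (sqrt_iter N k $$ (i, j))" for k
      using ij carrier_matD[OF iter_carrier[of k]] by (simp add: p[symmetric])
    ultimately show "(\<lambda>k. poly_mat (p k) (cmat A) $$ (i, j)) \<longlonglongrightarrow> cmat G $$ (i, j)"
      using ij carrier_matD[OF G_carrier] by simp
  qed (use G_carrier in simp)
  then obtain q where q: "cmat G = poly_mat q (cmat A)" by blast
  have "cmat (1\<^sub>m n - G) = 1 \<cdot>\<^sub>m 1\<^sub>m n - cmat G"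
    using G_carrier by (intro eq_matI) auto
  also have "\<dots> = poly_mat ([:1:] - q) (cmat A)"
    unfolding poly_mat_diff[OF cA] poly_mat_const[OF cA] q ..
  finally show ?thesis by blast
qed

lemma root_principal: "is_principal_sqrt (cmat A) (cmat (1\<^sub>m n - G))"
  unfolding is_principal_sqrt_def
proof (intro conjI allI impI)
  show "cmat (1\<^sub>m n - G) \<in> carrier_mat (dim_row (cmat A)) (dim_row (cmat A))"
    using root_carrier carrier_matD(1)[OF A_carrier] by (simp del: index_minus_mat)
  show "cmat (1\<^sub>m n - G) * cmat (1\<^sub>m n - G) = cmat A"
    by (rule of_real_hom.mat_hom_mult[OF root_carrier root_carrier, symmetric, unfolded root_square])
  show "\<exists>p. cmat (1\<^sub>m n - G) = poly_mat p (cmat A)" by (rule root_poly_mat)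
  fix z assume "eigenvalue (cmat (1\<^sub>m n - G)) z"
  \<comment> \<open>The closed disc of radius 1 about 1 lies in the closed right half plane.\<close>
  then have "cmod (1 - z) \<le> 1"
    using eigenvalue_cmat_norm_le_1[OF G_carrier rho_G] eigenvalue_one_minus[OF G_carrier] by blast
  then show "0 \<le> Re z" using complex_Re_le_cmod[of "1 - z"] by simp
qed

lemma rho_N: "rho N \<le> 1"
  by (rule power_bounded_imp_spectral_radius_le_1[OF _ n bound]) (use N in simp)

lemma cmat_A: "cmat A = 1\<^sub>m n - cmat N"
  using N by (intro eq_matI) auto

text \<open>Both conditions of the uniqueness result come from bounded powers of \<open>N\<close>:
  equality of the kernels of \<open>A\<close> and its square through
  \<open>power_bounded_ker_square\<close>, and nonnegative real eigenvalues through |1 - x| \<le>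
  1.\<close>

lemma principal_unique:
  assumes "is_principal_sqrt (cmat A) Y"
  shows "Y = cmat (1\<^sub>m n - G)"
proof (rule principal_sqrt_unique[OF _ _ _ assms root_principal])
  show cA: "cmat A \<in> carrier_mat n n" using A_carrier by simp
  show "cmat A *\<^sub>v v = 0\<^sub>v n" if "v \<in> carrier_vec n" "cmat A *\<^sub>v (cmat A *\<^sub>v v) = 0\<^sub>v n" for v
    using power_bounded_ker_square[OF _ bound that(1)] that(2) N by (simp add: cmat_A)
  show "0 \<le> x" if "eigenvalue (cmat A) (complex_of_real x)" for x
  proof -
    have "cmod (1 - complex_of_real x) \<le> 1"
      using eigenvalue_cmat_norm_le_1[OF N rho_N] eigenvalue_one_minus[OF N that] by blast
    then show ?thesis using complex_Re_le_cmod[of "1 - complex_of_real x"] by simp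
  qed
qed

text \<open>A polynomial in \<open>A\<close> acts on the kernel of \<open>A\<close> as a scalar, which has to square to \<open>0\<close>
  for a square root.\<close>

lemma G_fixes_ker:
  assumes u: "u \<in> carrier_vec n" and Au: "A *\<^sub>v u = 0\<^sub>v n"
  shows "G *\<^sub>v u = u"
proof -
  define R where "R = 1\<^sub>m n - G"
  have R: "R \<in> carrier_mat n n" unfolding R_def by (rule root_carrier)
  have cA: "cmat A \<in> carrier_mat n n" using A_carrier by simp
  define v where "v = map_vec complex_of_real u"
  have v: "v \<in> carrier_vec n" using u by (simp add: v_def)
  have hom: "cmat X *\<^sub>v v = map_vec complex_of_real (X *\<^sub>v u)" if "X \<in> carrier_mat n n" for X
    unfolding v_def by (rule of_real_hom.mult_mat_vec_hom[OF that u, symmetric])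
  obtain p where p: "cmat R = poly_mat p (cmat A)" using root_poly_mat unfolding R_def by blast
  have Av: "cmat A *\<^sub>v v = 0 \<cdot>\<^sub>v v"
    unfolding hom[OF A_carrier] Au using v by (intro eq_vecI) auto
  have Rv: "cmat R *\<^sub>v v = poly p 0 \<cdot>\<^sub>v v" unfolding p by (rule poly_mat_eigenvector[OF cA v Av])
  have RRv: "poly p 0 * poly p 0 * v $ i = 0" if i: "i < n" for i
  proof -
    have "0 \<cdot>\<^sub>v v = cmat (R * R) *\<^sub>v v" unfolding R_def root_square Av ..
    also have "\<dots> = poly_mat (p * p) (cmat A) *\<^sub>v v"
      unfolding of_real_hom.mat_hom_mult[OF R R] p poly_mat_mult[OF cA] ..
    also have "\<dots> = poly (p * p) 0 \<cdot>\<^sub>v v" by (rule poly_mat_eigenvector[OF cA v Av])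
    finally have "(poly (p * p) 0 \<cdot>\<^sub>v v) $ i = (0 \<cdot>\<^sub>v v) $ i" by (simp only:)
    then show ?thesis using i v by simp
  qed
  have "(R *\<^sub>v u) $ i = 0" if i: "i < n" for i
  proof -
    have "complex_of_real ((R *\<^sub>v u) $ i) = poly p 0 * v $ i"
      using arg_cong[OF Rv[unfolded hom[OF R]], of "\<lambda>u. u $ i"] i v carrier_matD[OF R] by simp
    also have "\<dots> = 0" using RRv[OF i] by auto
    finally show ?thesis by simp
  qed
  moreover have "R *\<^sub>v u = u - G *\<^sub>v u"
    unfolding R_def using G_carrier u by (simp add: minus_mult_distrib_mat_vec[of _ n n])
  ultimately show ?thesis using G_carrier u by (intro eq_vecI) auto
qed

text \<open>Singularity supplies a real kernel vector of \<open>A\<close>, of whatever signs. It is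
  fixed by \<open>G\<close>, so 1 is attained as an eigenvalue and the bound in \<open>rho_G\<close>
  is sharp.\<close>

lemma rho_G_singular:
  assumes "det A = 0"
  shows "rho G = 1" "eigenvalue (cmat G) 1"
proof -
  obtain u where u: "u \<in> carrier_vec n" "u \<noteq> 0\<^sub>v n" "A *\<^sub>v u = 0\<^sub>v n"
    using assms det_0_iff_vec_prod_zero[OF A_carrier] by blast
  define v where "v = map_vec complex_of_real u"
  have "cmat G *\<^sub>v v = v"
    using of_real_hom.mult_mat_vec_hom[OF G_carrier u(1), symmetric] G_fixes_ker[OF u(1,3)]
    by (simp add: v_def)
  moreover have "v \<noteq> 0\<^sub>v n"
  proof
    assume v0: "v = 0\<^sub>v n"
    have "u $ i = 0" if "i < n" for i
      using arg_cong[OF v0, of "\<lambda>w. w $ i"] that u(1) by (simp add: v_def)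
    with u show False by (metis carrier_vecD eq_vecI index_zero_vec)
  qed
  ultimately show ev: "eigenvalue (cmat G) 1"
    using G_carrier u unfolding eigenvalue_def eigenvector_def v_def
    by (intro exI[of _ "map_vec complex_of_real u"]) auto
  then have "1 \<in> norm ` spectrum (cmat G)" by (force simp: spectrum_def)
  then have "1 \<le> rho G" using spectral_radius_mem_max(2)[of "cmat G" n 1] G_carrier n by simp
  with rho_G show "rho G = 1" by simp
qed

lemma G_diag_pos:
  assumes "i < n" "N $$ (i, i) > 0"
  shows "G $$ (i, i) > 0"
proof -
  have "0 \<le> (G * G) $$ (i, i)"
    using nonneg_mat_mult[OF G_carrier G_nonneg G_carrier G_nonneg] assms(1)
      nonneg_mat_iff[OF mult_carrier_mat[OF G_carrier G_carrier]] by blast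
  then show ?thesis using G_fixpoint_index[OF assms(1,1)] assms(2) by linarith
qed

end

theorem theorem1:
  fixes n :: nat and A N :: "real mat"
  assumes "n > 0"
    and "N \<in> carrier_mat n n"
    and "A = 1\<^sub>m n - N"
    and "0\<^sub>m n n \<le> N"
    and "\<forall>i<n. N $$ (i, i) > 0"
    and "rho N \<le> 1"
    and "M_matrix n A"
    and "property_C A"
  shows "\<exists>G \<in> carrier_mat n n.
     mat_tendsto n (sqrt_iter N) G \<and>
     (\<exists>!Y. is_principal_sqrt (cmat A) Y) \<and>
     principal_sqrt (cmat A) = cmat (1\<^sub>m n - G) \<and>
     M_matrix n (1\<^sub>m n - G) \<and> 0\<^sub>m n n \<le> G \<and> rho G \<le> 1 \<and>
     minimal_nonneg_solution n (\<lambda>X. X * X - 2 \<cdot>\<^sub>m X + N = 0\<^sub>m n n) G \<and>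
     (det A = 0 \<longrightarrow> rho G = 1 \<and>
        (\<forall>u \<in> carrier_vec n. (\<forall>i<n. u $ i > 0) \<and> (1\<^sub>m n - N) *\<^sub>v u = 0\<^sub>v n \<longrightarrow> G *\<^sub>v u = u)) \<and>
     (det A = 0 \<and> simple_eigenvalue N 1 \<longrightarrow>
        (\<forall>z. eigenvalue (cmat G) z \<and> cmod z = 1 \<longleftrightarrow> z = 1))"
proof -
  note A = \<open>A = 1\<^sub>m n - N\<close>
  have "\<exists>c. \<forall>k. norm_bound (cmat N ^\<^sub>m k) c"
    using property_C_power_bounded[OF assms(2,4,6)] assms(5,8) unfolding A by blast
  then obtain c where "\<And>k. norm_bound (cmat N ^\<^sub>m k) c" by blast
  \<comment> \<open>Property C enters the construction of \<open>G\<close> through the constant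
    \<open>c\<close>.\<close>
  with assms interpret B: power_bounded_nonneg n N c by unfold_locales
  have "\<exists>!Y. is_principal_sqrt (cmat A) Y"
    using B.root_principal B.principal_unique unfolding A by blast
  moreover have "principal_sqrt (cmat A) = cmat (1\<^sub>m n - B.G)"
    unfolding principal_sqrt_def A using B.root_principal B.principal_unique by (rule the_equality)
  moreover have "M_matrix n (1\<^sub>m n - B.G)"
    unfolding M_matrix_def
    using B.G_carrier B.G_nonneg B.rho_G by (intro exI[of _ 1] exI[of _ B.G]) (auto intro!: eq_matI)
  moreover have "eigenvalue (cmat B.G) z \<and> cmod z = 1 \<longleftrightarrow> z = 1" if "det A = 0" for z
    using peripheral_eigenvalue_pos_diag[OF B.G_carrier B.G_nonneg B.rho_G B.G_diag_pos]
      B.rho_G_singular(2) that assms(5) unfolding A by auto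
  ultimately show ?thesis
    using B.G_carrier B.iter_tendsto B.G_nonneg B.rho_G B.G_minimal B.rho_G_singular(1) B.G_fixes_ker
    unfolding A by blast
qed

end
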